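(* Let $(X,d,\mu)$ be an $s$-Ahlfors-regular quasi-metric measure space. Then $\tilde B_{q,0}(X)=L^1(X)$ for all $1<q\le\infty$. In particular, $\|f\|_{\tilde B_{q,0}(X)}\approx\|f\|_{L^1(X)}$, i.e. there are positive constants $C_1,C_2$ independent of $f$ such that $C_1\|f\|_{L^1(X)}\le\|f\|_{\tilde B_{q,0}(X)}\le C_2\|f\|_{L^1(X)}$ for all $f\in L^1(X)$.
   Context: An $s$-Ahlfors-regular quasi-metric measure space $(X,d,\mu)$ is a set $X$ with a function $d:X\times X\to[0,\infty)$ such that $d(x,y)=d(y,x)$; $d(x,y)=0$ iff $x=y$; and for some constant $A\ge 1$, $d(x,y)\le A(d(x,z)+d(z,y))$ for all $x,y,z\in X$; together with a nonzero Borel regular measure $\mu$ on $X$ for which there are constants $c,C,s>0$ with $$c\,r^s\le\mu(B(x,r))\le C\,r^s,\qquad x\in X,\ 0<r<\operatorname{diam}(X),$$ where $B(x,r)=\{y\in X:d(x,y)<r\}$ (a ball) and $\operatorname{diam}(X)=\sup\{d(x,y):x,y\in X\}\in[0,\infty]$. Balls are understood to be $\mu$-measurable. Let $1<q\le\infty$, $q'$ its conjugate exponent ($\infty'=1$), and $\alpha\ge0$. A measurable function $a$ on $X$ is a $(q,\alpha)$-block if there is a ball $B(x,t)\subseteq X$ (with $0<\mu(B(x,t))<\infty$) such that $\operatorname{supp}a\subseteq B(x,t)$ (i.e. $a$ vanishes outside $B(x,t)$) and $\|a\|_{L^q(B(x,t))}\le\mu(B(x,t))^{-1/q'}t^\alpha$.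 For $\alpha=0$ the last condition is $\|a\|_{L^q(B(x,t))}\le\mu(B(x,t))^{-1/q'}$. The space $\tilde B_{q,\alpha}(X)$ consists of all $f\in L^1(X)$ admitting a decomposition $f=\sum_{j=1}^\infty\lambda_ja_j$ with $\lambda_j\in\mathbb C$, each $a_j$ a $(q,\alpha)$-block supported on a ball $B_j\subseteq X$, and $\sum_{j=1}^\infty|\lambda_j|<\infty$. Its norm is $\|f\|_{\tilde B_{q,\alpha}(X)}=\inf\sum_{j=1}^\infty|\lambda_j|$, the infimum being over all such decompositions. (For $\alpha=0$, $\|a_j\|_{L^1}\le1$ and the series converges absolutely in $L^1(X)$.)
   Formalization: When diam(X) is finite, μ is additionally assumed σ-finite; without it the claim fails, e.g. for a one-point space of infinite mass, where the Ahlfors bounds are vacuous and no blocks exist. *)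

theory Defs
  imports "HOL-Probability.Essential_Supremum"
begin

section \<open>Ahlfors-regular quasi-metric measure spaces\<close>

definition quasi_metric_on :: "'a set \<Rightarrow> ('a \<Rightarrow> 'a \<Rightarrow> real) \<Rightarrow> bool" where
  "quasi_metric_on X d \<longleftrightarrow>
     (\<forall>x\<in>X. \<forall>y\<in>X. 0 \<le> d x y \<and> d x y = d y x \<and> (d x y = 0 \<longleftrightarrow> x = y)) \<and>
     (\<exists>A\<ge>1. \<forall>x\<in>X. \<forall>y\<in>X. \<forall>z\<in>X. d x y \<le> A * (d x z + d z y))"

definition qball :: "'a set \<Rightarrow> ('a \<Rightarrow> 'a \<Rightarrow> real) \<Rightarrow> 'a \<Rightarrow> real \<Rightarrow> 'a set" where
  "qball X d x r = {y \<in> X. d x y < r}"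

definition qdiam :: "'a set \<Rightarrow> ('a \<Rightarrow> 'a \<Rightarrow> real) \<Rightarrow> ennreal" where
  "qdiam X d = (SUP x\<in>X. SUP y\<in>X. ennreal (d x y))"

text \<open>The topology induced by a quasi-metric. Balls need not be open in it.\<close>

definition quasi_open :: "'a set \<Rightarrow> ('a \<Rightarrow> 'a \<Rightarrow> real) \<Rightarrow> 'a set \<Rightarrow> bool" where
  "quasi_open X d U \<longleftrightarrow> U \<subseteq> X \<and> (\<forall>x\<in>U. \<exists>r>0. qball X d x r \<subseteq> U)"

definition quasi_borel_sets :: "'a set \<Rightarrow> ('a \<Rightarrow> 'a \<Rightarrow> real) \<Rightarrow> 'a set set" where
  "quasi_borel_sets X d = sigma_sets X {U. quasi_open X d U}"

definition borel_regular :: "'a measure \<Rightarrow> ('a \<Rightarrow> 'a \<Rightarrow> real) \<Rightarrow> bool" where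
  "borel_regular M d \<longleftrightarrow>
     quasi_borel_sets (space M) d \<subseteq> sets M \<and>
     (\<forall>E\<in>sets M. \<exists>G\<in>quasi_borel_sets (space M) d. E \<subseteq> G \<and> emeasure M G = emeasure M E)"

text \<open>The two-sided bound is required only for radii below the diameter. If the diameter is
  infinite it makes \<open>M\<close> sigma-finite; if the diameter is finite it does not: a single point of
  infinite mass satisfies it vacuously, and so does, with a suitable measure, an uncountable disjoint
  union of intervals at mutual distance equal to the diameter.\<close>

definition ahlfors_regular_space :: "'a measure \<Rightarrow> ('a \<Rightarrow> 'a \<Rightarrow> real) \<Rightarrow> real \<Rightarrow> bool" where
  "ahlfors_regular_space M d s \<longleftrightarrow>
     quasi_metric_on (space M) d \<and>
     (\<forall>x\<in>space M. \<forall>r. qball (space M) d x r \<in> sets M) \<and>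
     borel_regular M d \<and>
     emeasure M (space M) \<noteq> 0 \<and>
     0 < s \<and>
     (\<exists>c>0. \<exists>C>0. \<forall>x\<in>space M. \<forall>r>0. ennreal r < qdiam (space M) d \<longrightarrow>
        ennreal (c * r powr s) \<le> emeasure M (qball (space M) d x r) \<and>
        emeasure M (qball (space M) d x r) \<le> ennreal (C * r powr s))"

section \<open>Lebesgue norms and blocks\<close>

text \<open>The exponent \<open>q\<close> ranges over \<open>[1, \<infinity>]\<close>; the norm is \<open>\<infinity>\<close> exactly when a measurable
  function fails to be in the Lebesgue space.\<close>

definition Lq_norm :: "'a measure \<Rightarrow> ennreal \<Rightarrow> ('a \<Rightarrow> complex) \<Rightarrow> ennreal" where
  "Lq_norm N q f =
     (if q = \<infinity> then esssup N (\<lambda>x. ennreal (norm (f x)))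
      else let I = (\<integral>\<^sup>+x. ennreal (norm (f x) powr enn2real q) \<partial>N) in
           if I = \<infinity> then \<infinity> else ennreal (enn2real I powr (1 / enn2real q)))"

definition conj_exponent :: "ennreal \<Rightarrow> real" where
  "conj_exponent q = (if q = \<infinity> then 1 else enn2real q / (enn2real q - 1))"

definition is_block ::
    "'a measure \<Rightarrow> ('a \<Rightarrow> 'a \<Rightarrow> real) \<Rightarrow> ennreal \<Rightarrow> real \<Rightarrow> ('a \<Rightarrow> complex) \<Rightarrow> bool" where
  "is_block M d q \<alpha> a \<longleftrightarrow>
     a \<in> borel_measurable M \<and>
     (\<exists>x\<in>space M. \<exists>t>0. let B = qball (space M) d x t in
        0 < emeasure M B \<and> emeasure M B < \<infinity> \<and>
        (\<forall>y\<in>space M - B. a y = 0) \<and>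
        Lq_norm (restrict_space M B) q a
          \<le> ennreal (measure M B powr (- (1 / conj_exponent q)) * t powr \<alpha>))"

text \<open>The series \<open>\<Sum>j. \<lambda>\<^sub>j a\<^sub>j\<close> is required to converge to \<open>f\<close> in \<open>L\<^sup>1\<close>.\<close>

definition block_decomposition ::
    "'a measure \<Rightarrow> ('a \<Rightarrow> 'a \<Rightarrow> real) \<Rightarrow> ennreal \<Rightarrow> real \<Rightarrow> ('a \<Rightarrow> complex) \<Rightarrow>
     (nat \<Rightarrow> complex) \<Rightarrow> (nat \<Rightarrow> 'a \<Rightarrow> complex) \<Rightarrow> bool" where
  "block_decomposition M d q \<alpha> f l a \<longleftrightarrow>
     (\<forall>j. is_block M d q \<alpha> (a j)) \<and>
     summable (\<lambda>j. norm (l j)) \<and>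
     (\<lambda>n. Lq_norm M 1 (\<lambda>x. f x - (\<Sum>j<n. l j * a j x))) \<longlonglongrightarrow> 0"

definition L1_space :: "'a measure \<Rightarrow> ('a \<Rightarrow> complex) set" where
  "L1_space M = {f. integrable M f}"

definition L1_norm :: "'a measure \<Rightarrow> ('a \<Rightarrow> complex) \<Rightarrow> real" where
  "L1_norm M f = (\<integral>x. norm (f x) \<partial>M)"

definition block_space ::
    "'a measure \<Rightarrow> ('a \<Rightarrow> 'a \<Rightarrow> real) \<Rightarrow> ennreal \<Rightarrow> real \<Rightarrow> ('a \<Rightarrow> complex) set" where
  "block_space M d q \<alpha> = {f \<in> L1_space M. \<exists>l a. block_decomposition M d q \<alpha> f l a}"

text \<open>Meaningful only for members of \<open>block_space M d q \<alpha>\<close>, where the infimum is over a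
  nonempty set.\<close>

definition block_norm ::
    "'a measure \<Rightarrow> ('a \<Rightarrow> 'a \<Rightarrow> real) \<Rightarrow> ennreal \<Rightarrow> real \<Rightarrow> ('a \<Rightarrow> complex) \<Rightarrow> real" where
  "block_norm M d q \<alpha> f = Inf {(\<Sum>j. norm (l j)) | l. \<exists>a. block_decomposition M d q \<alpha> f l a}"

end

theory Submission
  imports Defs
begin

text \<open>A function bounded by \<open>h\<close> and supported in a ball \<open>B\<close> is \<open>h \<mu>(B)\<close> times a block, for every
  exponent \<open>q\<close>. Hence it suffices to cut the level sets \<open>E\<^sub>k = {2\<^sup>k\<^sup>-\<^sup>1 < \<bar>f\<bar> \<le> 2\<^sup>k}\<close> into disjoint
  pieces contained in balls whose total measure is at most a constant times \<open>\<mu>(E\<^sub>k)\<close>: the pieces of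
  \<open>f\<close> then form a block decomposition with coefficient sum at most a constant times
  \<open>\<Sum>k. 2\<^sup>k \<mu>(E\<^sub>k) \<le> 2 \<parallel>f\<parallel>\<^sub>1\<close>. Such balls come from the Vitali covering lemma applied inside an
  open set \<open>U \<supseteq> E\<^sub>k\<close> with \<open>\<mu>(U) \<le> 2 \<mu>(E\<^sub>k)\<close>, together with doubling. As balls need not be open, outer
  regularity uses that the interior of a ball is open and contains a smaller concentric ball. The opposite
  inequality holds with constant 1 because every block has \<open>L\<^sup>1\<close> norm at most 1.\<close>

section \<open>Topology and coverings in quasi-metric spaces\<close>

locale quasi_metric_space =
  fixes X :: "'a set" and d :: "'a \<Rightarrow> 'a \<Rightarrow> real" and A :: real
  assumes nonneg: "x \<in> X \<Longrightarrow> y \<in> X \<Longrightarrow> 0 \<le> d x y"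
    and commute: "x \<in> X \<Longrightarrow> y \<in> X \<Longrightarrow> d x y = d y x"
    and zero_iff: "x \<in> X \<Longrightarrow> y \<in> X \<Longrightarrow> d x y = 0 \<longleftrightarrow> x = y"
    and ge_1: "1 \<le> A"
    and triangle: "x \<in> X \<Longrightarrow> y \<in> X \<Longrightarrow> z \<in> X \<Longrightarrow> d x y \<le> A * (d x z + d z y)"
begin

lemma centre_in_qball: "x \<in> X \<Longrightarrow> 0 < r \<Longrightarrow> x \<in> qball X d x r"
  using zero_iff[of x x] by (simp add: qball_def)

text \<open>Two steps of length below \<open>r / (2 * A)\<close> add up to less than
  \<open>r\<close> in the quasi-triangle inequality. This replaces the openness of balls in a metric
  space and is the source of every factor \<open>2 * A\<close> in the topological arguments.\<close>

lemma qball_shift: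
  assumes "x \<in> X" "y \<in> qball X d x (r / (2 * A))"
  shows "qball X d y (r / (2 * A)) \<subseteq> qball X d x r"
proof
  fix z assume z: "z \<in> qball X d y (r / (2 * A))"
  have "d x z \<le> A * (d x y + d y z)"
    using assms z by (intro triangle) (auto simp: qball_def)
  also have "\<dots> < A * (r / (2 * A) + r / (2 * A))"
    using assms z ge_1 by (intro mult_strict_left_mono add_strict_mono) (auto simp: qball_def)
  also have "\<dots> = r"
    using ge_1 by (simp add: field_simps)
  finally show "z \<in> qball X d x r"
    using z by (simp add: qball_def)
qed

section \<open>Interiors and the induced topology\<close>

definition qinterior :: "'a set \<Rightarrow> 'a set" where
  "qinterior S = {x \<in> X. \<exists>r>0. qball X d x r \<subseteq> S}"

lemma qinterior_subset: "qinterior S \<subseteq> S"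
  using centre_in_qball by (auto simp: qinterior_def)

lemma qinterior_mono: "S \<subseteq> T \<Longrightarrow> qinterior S \<subseteq> qinterior T"
  unfolding qinterior_def by blast

lemma half_qball_subset_qinterior:
  assumes "x \<in> X" "0 < r"
  shows "qball X d x (r / (2 * A)) \<subseteq> qinterior (qball X d x r)"
proof
  fix y assume y: "y \<in> qball X d x (r / (2 * A))"
  have "0 < r / (2 * A)"
    using ge_1 assms by simp
  then show "y \<in> qinterior (qball X d x r)"
    unfolding qinterior_def using qball_shift[OF assms(1) y] y by (auto simp: qball_def)
qed

text \<open>If the ball of radius \<open>r\<close> about \<open>x\<close> lies in \<open>S\<close>,
  then each point of the concentric ball of radius \<open>r / (2 * A)\<close> again has a ball
  inside \<open>S\<close>, so an interior point has a whole ball of interior points.\<close>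

lemma quasi_open_qinterior: "quasi_open X d (qinterior S)"
  unfolding quasi_open_def
proof (intro conjI ballI)
  fix x assume "x \<in> qinterior S"
  then obtain r where r: "x \<in> X" "0 < r" "qball X d x r \<subseteq> S"
    by (auto simp: qinterior_def)
  then have "qball X d x (r / (2 * A)) \<subseteq> qinterior S"
    using half_qball_subset_qinterior qinterior_mono by blast
  moreover have "0 < r / (2 * A)"
    using ge_1 r by simp
  ultimately show "\<exists>r>0. qball X d x r \<subseteq> qinterior S"
    by blast
qed (auto simp: qinterior_def)

lemma quasi_open_carrier: "quasi_open X d X"
  unfolding quasi_open_def qball_def by (auto intro: zero_less_one)

lemma quasi_open_empty: "quasi_open X d {}"
  by (simp add: quasi_open_def)

lemma quasi_open_subset: "quasi_open X d U \<Longrightarrow> U \<subseteq> X"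
  by (simp add: quasi_open_def)

lemma quasi_openE:
  assumes "quasi_open X d U" "x \<in> U"
  obtains r where "0 < r" "qball X d x r \<subseteq> U"
  using assms by (auto simp: quasi_open_def)

lemma quasi_open_UN:
  assumes "\<And>i. i \<in> I \<Longrightarrow> quasi_open X d (U i)"
  shows "quasi_open X d (\<Union>i\<in>I. U i)"
  unfolding quasi_open_def
proof (intro conjI ballI)
  show "(\<Union>i\<in>I. U i) \<subseteq> X"
    using assms quasi_open_subset by blast
  fix x assume "x \<in> (\<Union>i\<in>I. U i)"
  then obtain i where i: "i \<in> I" "x \<in> U i"
    by blast
  then obtain r where "0 < r" "qball X d x r \<subseteq> U i"
    using assms quasi_openE by metis
  then show "\<exists>r>0. qball X d x r \<subseteq> (\<Union>i\<in>I. U i)"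
    using i by blast
qed

lemma quasi_open_Int:
  assumes "quasi_open X d U" "quasi_open X d V"
  shows "quasi_open X d (U \<inter> V)"
  unfolding quasi_open_def
proof (intro conjI ballI)
  fix x assume "x \<in> U \<inter> V"
  then obtain r t where "0 < r" "qball X d x r \<subseteq> U" "0 < t" "qball X d x t \<subseteq> V"
    using assms unfolding quasi_open_def by blast
  then have "0 < min r t" "qball X d x (min r t) \<subseteq> U \<inter> V"
    by (auto simp: qball_def)
  then show "\<exists>r>0. qball X d x r \<subseteq> U \<inter> V"
    by blast
qed (use assms in \<open>auto simp: quasi_open_def\<close>)

text \<open>\<open>V n\<close> is an open neighbourhood of \<open>X - U\<close> of width about
  \<open>1 / Suc n\<close>, built from interiors because balls may fail to be open. Every point
  outside \<open>U\<close> lies in all \<open>V n\<close>, while a point of \<open>U\<close> with a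
  ball of radius \<open>r\<close> inside \<open>U\<close> leaves \<open>V n\<close> once
  \<open>1 / Suc n < r\<close>. The closed sets \<open>X - V n\<close> therefore exhaust
  \<open>U\<close>. This is the base case of the regularity induction.\<close>

lemma quasi_open_F_sigma:
  assumes U: "quasi_open X d U"
  obtains F :: "nat \<Rightarrow> 'a set"
  where "\<And>n. quasi_open X d (X - F n)" "incseq F" "\<Union>(range F) = U"
proof
  define V where "V n = (\<Union>y\<in>X - U. qinterior (qball X d y (1 / Suc n)))" for n
  have V: "quasi_open X d (V n)" for n
    unfolding V_def by (intro quasi_open_UN quasi_open_qinterior)
  then have V_sub: "V n \<subseteq> X" for n
    by (simp add: quasi_open_def)
  show "quasi_open X d (X - (X - V n))" for n
    using V V_sub by (simp add: double_diff)
  show "incseq (\<lambda>n. X - V n)"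
  proof (intro incseq_SucI Diff_mono order_refl)
    have "qball X d y (1 / Suc (Suc n)) \<subseteq> qball X d y (1 / Suc n)" for y n
    proof -
      have "1 / real (Suc (Suc n)) \<le> 1 / Suc n"
        by (simp add: divide_simps)
      then show ?thesis
        by (auto simp: qball_def)
    qed
    then show "V (Suc n) \<subseteq> V n" for n
      unfolding V_def by (intro UN_mono order_refl qinterior_mono)
  qed
  have V_outside: "x \<in> V n" if "x \<in> X - U" for x n
  proof -
    have "x \<in> qball X d x ((1 / Suc n) / (2 * A))"
      using that ge_1 by (intro centre_in_qball) auto
    also have "\<dots> \<subseteq> qinterior (qball X d x (1 / Suc n))"
      using that by (intro half_qball_subset_qinterior) auto
    finally show ?thesis
      using that by (auto simp: V_def)
  qed
  have V_inside: "\<exists>n. x \<notin> V n" if "x \<in> U" for x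
  proof -
    obtain r where r: "0 < r" "qball X d x r \<subseteq> U"
      using U \<open>x \<in> U\<close> by (rule quasi_openE)
    then obtain n where n: "1 / Suc n < r"
      using nat_approx_posE by blast
    have "x \<in> X"
      using U that by (auto simp: quasi_open_def)
    have "x \<notin> V n"
    proof
      assume "x \<in> V n"
      then obtain y where y: "y \<in> X - U" "x \<in> qball X d y (1 / Suc n)"
        using qinterior_subset unfolding V_def by blast
      then have "d x y < r"
        using n commute[of x y] \<open>x \<in> X\<close> by (auto simp: qball_def)
      then show False
        using r y by (auto simp: qball_def)
    qed
    then show ?thesis ..
  qed
  show "\<Union>(range (\<lambda>n. X - V n)) = U"
  proof (intro equalityI subsetI)
    fix x assume "x \<in> U"
    then show "x \<in> \<Union>(range (\<lambda>n. X - V n))"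
      using V_inside[of x] quasi_open_subset[OF U] by auto
  next
    fix x assume "x \<in> \<Union>(range (\<lambda>n. X - V n))"
    then show "x \<in> U"
      using V_outside[of x] by auto
  qed
qed

text \<open>Because the radii are dyadic, a largest ball among any nonempty collection exists, so that the
  selected ball meeting a given ball may be taken at least as large as the latter.\<close>

lemma Vitali_covering:
  fixes k :: "'a \<Rightarrow> nat" and R :: real
  assumes E: "E \<subseteq> X" and R: "0 < R"
  defines "\<rho> x \<equiv> R / 2 ^ k x"
  obtains S where "S \<subseteq> E" "disjoint_family_on (\<lambda>x. qball X d x (\<rho> x)) S"
    "E \<subseteq> (\<Union>z\<in>S. qball X d z (2 * A * \<rho> z))"
proof -
  define B where "B x = qball X d x (\<rho> x)" for x
  \<comment> \<open>The last clause says that a ball meeting some selected ball meets one at least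
    as large, since a smaller \<open>k\<close> means a larger radius. The clause survives unions of
    chains, so Zorn's lemma gives a maximal selection.\<close>
  define \<A> where "\<A> = {S. S \<subseteq> E \<and> disjoint_family_on B S \<and>
    (\<forall>x\<in>E. \<forall>y\<in>S. B x \<inter> B y \<noteq> {} \<longrightarrow> (\<exists>z\<in>S. B x \<inter> B z \<noteq> {} \<and> k z \<le> k x))}"
  have "\<exists>S\<in>\<A>. \<forall>T\<in>\<A>. S \<subseteq> T \<longrightarrow> T = S"
  proof (rule subset_Zorn')
    fix C assume C: "subset.chain \<A> C"
    then have sub: "C \<subseteq> \<A>" and cmp: "\<And>S T. S \<in> C \<Longrightarrow> T \<in> C \<Longrightarrow> S \<subseteq> T \<or> T \<subseteq> S"
      by (auto simp: subset.chain_def)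
    have "disjoint_family_on B (\<Union>C)"
      unfolding disjoint_family_on_def
    proof (intro ballI impI)
      fix x y assume "x \<in> \<Union>C" "y \<in> \<Union>C" "x \<noteq> y"
      then obtain S where "S \<in> C" "x \<in> S" "y \<in> S"
        using cmp by blast
      then show "B x \<inter> B y = {}"
        using sub \<open>x \<noteq> y\<close> unfolding \<A>_def disjoint_family_on_def by blast
    qed
    then show "\<Union>C \<in> \<A>"
      using sub unfolding \<A>_def by blast
  qed
  then obtain S where S: "S \<in> \<A>" and max: "\<And>T. T \<in> \<A> \<Longrightarrow> S \<subseteq> T \<Longrightarrow> T = S"
    by blast
  have B_self: "x \<in> B x" if "x \<in> E" for x
    unfolding B_def \<rho>_def using that E R by (intro centre_in_qball) auto
  have meets: "\<exists>y\<in>S. B x \<inter> B y \<noteq> {}" if x: "x \<in> E" for x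
  proof (rule ccontr)
    define N where "N = {x \<in> E. \<forall>y\<in>S. B x \<inter> B y = {}}"
    assume "\<not> ?thesis"
    then have "x \<in> N"
      using x by (auto simp: N_def)
    \<comment> \<open>Among the points whose ball misses the whole selection, one with the largest
      ball is added. A ball that meets only the new one is then no larger than it, so the enlarged
      selection stays in \<open>\<A>\<close>, against maximality.\<close>
    then obtain x0 where x0: "x0 \<in> N" and min: "\<And>x. x \<in> N \<Longrightarrow> k x0 \<le> k x"
      using ex_has_least_nat[of "\<lambda>x. x \<in> N" x k] by blast
    have "disjoint_family_on B (insert x0 S)"
      using x0 S unfolding N_def \<A>_def disjoint_family_on_def by blast
    moreover have "\<exists>z\<in>insert x0 S. B x \<inter> B z \<noteq> {} \<and> k z \<le> k x"
      if "x \<in> E" "y \<in> insert x0 S" "B x \<inter> B y \<noteq> {}" for x y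
    proof (cases "x \<in> N")
      case True
      then show ?thesis
        using that min by (auto simp: N_def)
    next
      case False
      then show ?thesis
        using that(1) S unfolding N_def \<A>_def by blast
    qed
    ultimately have "insert x0 S \<in> \<A>"
      using x0 S unfolding N_def \<A>_def by blast
    then have "x0 \<in> S"
      using max by blast
    then show False
      using x0 B_self unfolding N_def by blast
  qed
  have "x \<in> (\<Union>z\<in>S. qball X d z (2 * A * \<rho> z))" if x: "x \<in> E" for x
  proof -
    obtain z where z: "z \<in> S" "B x \<inter> B z \<noteq> {}" "k z \<le> k x"
      using meets[OF x] S x unfolding \<A>_def by blast
    then obtain w where w: "w \<in> B x" "w \<in> B z"
      by blast
    have zX: "z \<in> X" and xX: "x \<in> X" and wX: "w \<in> X"
      using z S E x w by (auto simp: \<A>_def B_def qball_def)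
    have "\<rho> x \<le> \<rho> z"
      unfolding \<rho>_def using R z by (intro divide_left_mono power_increasing) auto
    \<comment> \<open>Only the centre \<open>x\<close> has to be covered, not its ball, so one
      application of the quasi-triangle inequality through a common point \<open>w\<close> suffices
      and the dilation factor is \<open>2 * A\<close>.\<close>
    have "d z x \<le> A * (d z w + d w x)"
      using zX xX wX by (rule triangle)
    also have "\<dots> < A * (\<rho> z + \<rho> z)"
      using w \<open>\<rho> x \<le> \<rho> z\<close> ge_1 commute[OF wX xX]
      by (intro mult_strict_left_mono add_strict_mono) (auto simp: B_def qball_def)
    finally show ?thesis
      using z xX by (auto simp: qball_def algebra_simps)
  qed
  then show ?thesis
    using that[of S] S unfolding \<A>_def B_def by blast
qed

end

section \<open>Measures on quasi-metric spaces\<close>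

text \<open>Inside a set \<open>A i\<close> of finite measure the disjoint pieces
  \<open>A i \<inter> B x\<close> have summable measures, so only countably many are nonzero. An
  \<open>x\<close> that contributes to no \<open>A i\<close> would have \<open>B x\<close> null. A
  Vitali selection, which Zorn's lemma produces without any enumeration, becomes countable in this
  way.\<close>

lemma (in sigma_finite_measure) countable_disjoint_positive:
  assumes disj: "disjoint_family_on B S"
    and sets: "\<And>x. x \<in> S \<Longrightarrow> B x \<in> sets M"
    and pos: "\<And>x. x \<in> S \<Longrightarrow> 0 < emeasure M (B x)"
  shows "countable S"
proof -
  obtain A :: "nat \<Rightarrow> 'a set" where A: "range A \<subseteq> sets M" "(\<Union>i. A i) = space M"
    "\<And>i. emeasure M (A i) \<noteq> \<infinity>"
    using sigma_finite by blast
  define P where "P i = {x \<in> S. measure M (A i \<inter> B x) \<noteq> 0}" for i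
  have AB: "A i \<inter> B x \<in> sets M" "emeasure M (A i \<inter> B x) \<noteq> \<infinity>" if "x \<in> S" for i x
  proof -
    show "A i \<inter> B x \<in> sets M"
      using A sets that by blast
    have "emeasure M (A i \<inter> B x) \<le> emeasure M (A i)"
      using A by (intro emeasure_mono) auto
    then show "emeasure M (A i \<inter> B x) \<noteq> \<infinity>"
      using A(3)[of i] by (auto simp: top_unique)
  qed
  have "countable (P i)" for i
  proof -
    have "(\<lambda>x. measure M (A i \<inter> B x)) summable_on S"
    proof (rule nonneg_bdd_above_summable_on)
      have "(\<Sum>x\<in>F. measure M (A i \<inter> B x)) \<le> measure M (A i)" if "F \<subseteq> S" "finite F" for F
      proof -
        have "disjoint_family_on (\<lambda>x. A i \<inter> B x) F"
          using that(1) disj unfolding disjoint_family_on_def by fast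
        then have "(\<Sum>x\<in>F. measure M (A i \<inter> B x)) = measure M (\<Union>x\<in>F. A i \<inter> B x)"
          using that AB by (intro measure_finite_Union[symmetric]) auto
        also have "\<dots> \<le> measure M (A i)"
        proof (rule measure_mono_fmeasurable)
          show "(\<Union>x\<in>F. A i \<inter> B x) \<in> sets M"
            using that AB by (intro sets.finite_UN) auto
          show "A i \<in> fmeasurable M"
            using A by (auto simp: fmeasurable_def top.not_eq_extremum)
        qed auto
        finally show ?thesis .
      qed
      then show "bdd_above (sum (\<lambda>x. measure M (A i \<inter> B x)) ` {F. F \<subseteq> S \<and> finite F})"
        by (auto intro!: bdd_aboveI)
    qed simp
    then show ?thesis
      unfolding P_def by (rule summable_countable_real)
  qed
  moreover have "S \<subseteq> (\<Union>i. P i)"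
  proof (rule ccontr)
    assume "\<not> ?thesis"
    then obtain x where x: "x \<in> S" "\<And>i. measure M (A i \<inter> B x) = 0"
      by (auto simp: P_def)
    then have "A i \<inter> B x \<in> null_sets M" for i
      using AB[OF x(1)] by (intro null_setsI) (auto simp: measure_eq_emeasure_eq_ennreal emeasure_eq_ennreal_measure)
    then have "(\<Union>i. A i \<inter> B x) \<in> null_sets M"
      by (rule null_sets_UN)
    moreover have "(\<Union>i. A i \<inter> B x) = B x"
      using A(2) sets.sets_into_space[OF sets[OF x(1)]] by blast
    ultimately show False
      using pos[OF x(1)] by (auto dest: null_setsD1)
  qed
  ultimately show ?thesis
    by (auto intro: countable_subset[of S "\<Union>i. P i"])
qed

context quasi_metric_space
begin

lemma closed_UN_lessThan:
  assumes "\<And>i. quasi_open X d (X - F i)"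
  shows "quasi_open X d (X - (\<Union>i<n::nat. F i))"
proof (induction n)
  case (Suc n)
  have "X - (\<Union>i<Suc n. F i) = (X - (\<Union>i<n. F i)) \<inter> (X - F n)"
    by (auto simp: less_Suc_eq)
  then show ?case
    using quasi_open_Int[OF Suc assms] by simp
qed (simp add: quasi_open_carrier)

text \<open>The sets that can be squeezed between a closed and an open set with small difference
  contain the open sets and form a sigma-algebra. Approximating from both sides makes the property
  symmetric under complements, so the induction over \<open>sigma_sets\<close> goes through.\<close>

lemma finite_Borel_measure_regular:
  assumes "finite_measure N" and space: "space N = X"
    and Borel: "quasi_borel_sets X d \<subseteq> sets N"
    and "E \<in> quasi_borel_sets X d" "0 < e"
  shows "\<exists>F U. quasi_open X d (X - F) \<and> quasi_open X d U \<and> F \<subseteq> E \<and> E \<subseteq> U \<and> measure N (U - F) < e"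
proof -
  interpret N: finite_measure N by fact
  have open_sets: "U \<in> sets N" if "quasi_open X d U" for U
    using Borel that unfolding quasi_borel_sets_def by (auto intro: sigma_sets.Basic)
  have closed_sets: "F \<in> sets N" if "quasi_open X d (X - F)" "F \<subseteq> X" for F
    using sets.compl_sets[OF open_sets[OF that(1)]] that(2) by (simp add: space double_diff)
  have "E \<in> sigma_sets X {U. quasi_open X d U}"
    using assms by (simp add: quasi_borel_sets_def)
  then show ?thesis
    using \<open>0 < e\<close>
  proof (induction arbitrary: e)
    case (Basic U)
    then have U: "quasi_open X d U"
      by simp
    obtain F :: "nat \<Rightarrow> 'a set" where F: "\<And>n. quasi_open X d (X - F n)" "incseq F" "\<Union>(range F) = U"
      using quasi_open_F_sigma[OF U] by blast
    have F_sets: "F n \<in> sets N" for n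
      using closed_sets[OF F(1)] F(3) quasi_open_subset[OF U] by blast
    have "(\<lambda>n. measure N (F n)) \<longlonglongrightarrow> measure N U"
      using N.finite_Lim_measure_incseq[of F] F F_sets by (auto simp: image_subset_iff)
    then have "eventually (\<lambda>n. measure N U - e < measure N (F n)) sequentially"
      using \<open>0 < e\<close> by (intro order_tendstoD(1)) auto
    then obtain n where "measure N U - e < measure N (F n)"
      by (auto simp: eventually_sequentially)
    moreover have "measure N (U - F n) = measure N U - measure N (F n)"
      using F(3) by (intro N.finite_measure_Diff F_sets open_sets U) auto
    ultimately show ?case
      using F U by (intro exI[of _ "F n"] exI[of _ U]) auto
  next
    case Empty
    then show ?case
      using quasi_open_empty quasi_open_carrier by (intro exI[of _ "{}"]) simp
  next
    case (Compl E)
    obtain F U where FU: "quasi_open X d (X - F)" "quasi_open X d U" "F \<subseteq> E" "E \<subseteq> U"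
      "measure N (U - F) < e"
      using Compl by meson
    moreover have "(X - F) - (X - U) = U - F"
      using quasi_open_subset[OF FU(2)] by blast
    moreover have "X - (X - U) = U"
      using quasi_open_subset[OF FU(2)] by blast
    ultimately show ?case
      by (intro exI[of _ "X - U"] exI[of _ "X - F"]) auto
  next
    case (Union E)
    \<comment> \<open>Geometric shares of \<open>e / 2\<close>: non-strict bounds in the limit still
      leave room for the strict inequality with \<open>e\<close>.\<close>
    define \<epsilon> where "\<epsilon> i = e / 2 * (1 / 2) ^ Suc i" for i :: nat
    have "0 < \<epsilon> i" for i
      using Union.prems by (simp add: \<epsilon>_def)
    then have "\<exists>F U. quasi_open X d (X - F) \<and> quasi_open X d U \<and> F \<subseteq> E i \<and> E i \<subseteq> U \<and>
        measure N (U - F) < \<epsilon> i" for i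
      by (rule Union.IH)
    then obtain F U where F: "\<And>i. quasi_open X d (X - F i)" and U: "\<And>i. quasi_open X d (U i)"
      and FEU: "\<And>i. F i \<subseteq> E i" "\<And>i. E i \<subseteq> U i" and small: "\<And>i. measure N (U i - F i) < \<epsilon> i"
      by metis
    have F_sets: "F i \<in> sets N" and U_sets: "U i \<in> sets N" for i
      using closed_sets[OF F] open_sets[OF U] FEU quasi_open_subset[OF U] by blast+
    define V where "V = (\<Union>i. U i)"
    have V: "quasi_open X d V"
      unfolding V_def by (intro quasi_open_UN U)
    have "\<epsilon> sums (e / 2)"
      unfolding \<epsilon>_def using sums_mult[OF power_half_series, of "e / 2"] by simp
    then have summable: "summable \<epsilon>" and suminf: "suminf \<epsilon> = e / 2"
      by (auto simp: sums_iff)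
    have summable': "summable (\<lambda>i. measure N (U i - F i))"
      using small by (intro summable_comparison_test'[OF summable]) (auto intro: less_imp_le)
    have "measure N (V - (\<Union>i. F i)) \<le> measure N (\<Union>i. U i - F i)"
      using F_sets U_sets by (intro N.finite_measure_mono) (auto simp: V_def)
    also have "\<dots> \<le> (\<Sum>i. measure N (U i - F i))"
      using F_sets U_sets summable' by (intro N.finite_measure_subadditive_countably) auto
    also have "\<dots> \<le> e / 2"
      unfolding suminf[symmetric] using small
      by (intro suminf_le summable summable') (auto intro: less_imp_le)
    finally have "measure N (V - (\<Union>i. F i)) < e"
      using \<open>0 < e\<close> by simp
    \<comment> \<open>A countable union of closed sets need not be closed. Continuity from above of
      the finite measure allows it to be replaced by a finite union at the cost of the remaining
      half of \<open>e\<close>.\<close>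
    moreover have "(\<lambda>n. measure N (V - (\<Union>i<n. F i))) \<longlonglongrightarrow> measure N (\<Inter>n. V - (\<Union>i<n. F i))"
    proof (rule N.finite_Lim_measure_decseq)
      show "range (\<lambda>n. V - (\<Union>i<n. F i)) \<subseteq> sets N"
        using open_sets[OF V] F_sets by auto
      show "decseq (\<lambda>n. V - (\<Union>i<n. F i))"
        unfolding decseq_def by (fastforce dest: less_le_trans)
    qed
    moreover have "(\<Inter>n. V - (\<Union>i<n. F i)) = V - (\<Union>i. F i)"
      by auto
    ultimately have "eventually (\<lambda>n. measure N (V - (\<Union>i<n. F i)) < e) sequentially"
      using order_tendstoD(2) by metis
    then obtain n where "measure N (V - (\<Union>i<n. F i)) < e"
      by (auto simp: eventually_sequentially)
    then show ?case
      using closed_UN_lessThan[of F, OF F] V FEU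
      by - (rule exI[of _ "\<Union>i<n. F i"], rule exI[of _ V], auto simp: V_def, blast+)
  qed
qed

end

section \<open>Coverings under local doubling\<close>

text \<open>The requirements that \<open>is_block\<close> puts on its ball, with centre and radius
  forgotten: for \<alpha> = 0 the norm bound depends on the ball only through its measure.\<close>

definition good_ball :: "'a measure \<Rightarrow> ('a \<Rightarrow> 'a \<Rightarrow> real) \<Rightarrow> 'a set \<Rightarrow> bool" where
  "good_ball M d B \<longleftrightarrow> (\<exists>x\<in>space M. \<exists>t>0. B = qball (space M) d x t) \<and>
     B \<in> sets M \<and> 0 < emeasure M B \<and> emeasure M B < \<infinity>"

text \<open>The consequences of Ahlfors regularity on which the coverings rest. They are limited to
  radii up to \<open>r0\<close> because regularity controls only radii below the diameter. Doubling
  is stated for the factor \<open>2 * A\<close>, the dilation of the Vitali covering.\<close>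

locale locally_doubling_space = quasi_metric_space "space M" d A + sigma_finite_measure M
  for M :: "'a measure" and d A +
  fixes r0 D :: real
  assumes qball_sets: "x \<in> space M \<Longrightarrow> qball (space M) d x r \<in> sets M"
    and nonempty: "space M \<noteq> {}"
    and regular: "borel_regular M d"
    and r0_pos: "0 < r0"
    and D_pos: "0 < D"
    and qball_pos: "x \<in> space M \<Longrightarrow> 0 < r \<Longrightarrow> r \<le> r0 \<Longrightarrow> 0 < emeasure M (qball (space M) d x r)"
    and qball_finite: "x \<in> space M \<Longrightarrow> 0 < r \<Longrightarrow> r \<le> r0 \<Longrightarrow> emeasure M (qball (space M) d x r) < \<infinity>"
    and doubling: "x \<in> space M \<Longrightarrow> 0 < r \<Longrightarrow> 2 * A * r \<le> r0 \<Longrightarrow>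
      emeasure M (qball (space M) d x (2 * A * r)) \<le> ennreal D * emeasure M (qball (space M) d x r)"
begin

lemma good_ball_small:
  "x \<in> space M \<Longrightarrow> 0 < r \<Longrightarrow> r \<le> r0 \<Longrightarrow> good_ball M d (qball (space M) d x r)"
  unfolding good_ball_def using qball_sets qball_pos qball_finite by blast

lemma quasi_open_sets: "quasi_open (space M) d U \<Longrightarrow> U \<in> sets M"
  using regular unfolding borel_regular_def quasi_borel_sets_def by (auto intro: sigma_sets.Basic)

text \<open>Restricting \<open>M\<close> to \<open>W\<close> gives a finite measure
  \<open>N\<close>, for which Borel sets are regular. Borel regularity of \<open>M\<close> first
  replaces \<open>E\<close> by a Borel set \<open>G\<close> of the same measure. The open set found
  for \<open>G\<close> is finally cut down to \<open>W\<close>, where \<open>N\<close> and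
  \<open>M\<close> agree.\<close>

lemma outer_regular:
  assumes W: "quasi_open (space M) d W" "emeasure M W < \<infinity>"
    and E: "E \<in> sets M" "E \<subseteq> W" "0 < emeasure M E"
  obtains U where "quasi_open (space M) d U" "E \<subseteq> U" "emeasure M U \<le> 2 * emeasure M E"
proof -
  define N where "N = density M (indicator W)"
  have N: "emeasure N G = emeasure M (W \<inter> G)" if "G \<in> sets M" for G
    unfolding N_def using that quasi_open_sets[OF W(1)] by (rule emeasure_restricted[rotated])
  have spN: "space N = space M" "sets N = sets M"
    by (auto simp: N_def)
  have WM: "W \<in> sets M" by (rule quasi_open_sets[OF W(1)])
  interpret N: finite_measure N
    using W sets.sets_into_space[OF WM] by (intro finite_measureI) (simp add: spN N Int_absorb2)
  obtain G where G: "G \<in> quasi_borel_sets (space M) d" "E \<subseteq> G" "emeasure M G = emeasure M E"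
    using regular E unfolding borel_regular_def by blast
  have Borel: "quasi_borel_sets (space M) d \<subseteq> sets N"
    using regular by (simp add: borel_regular_def spN)
  have G_sets: "G \<in> sets M"
    using G Borel spN by auto
  have finE: "emeasure M E < \<infinity>"
    using emeasure_mono[OF E(2) WM] W(2) by (rule order.strict_trans1)
  then have "0 < measure M E"
    using E(3) by (simp add: measure_def enn2real_positive_iff)
  \<comment> \<open>The permitted error is the measure of \<open>E\<close> itself, which is
    positive; this produces the factor 2.\<close>
  then obtain F U where FU: "quasi_open (space M) d (space M - F)" "quasi_open (space M) d U" 
      "F \<subseteq> G" "G \<subseteq> U" "measure N (U - F) < measure M E"
    using finite_Borel_measure_regular[OF N.finite_measure_axioms spN(1) Borel G(1)] by blast
  have U_sets: "U \<in> sets M"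
    using FU quasi_open_sets by blast
  have F_sets: "F \<in> sets M"
    using sets.compl_sets[OF quasi_open_sets[OF FU(1)]] FU(3) G_sets sets.sets_into_space
    by (metis double_diff order_refl order_trans)
  have "measure N U = measure N G + measure N (U - G)"
    using FU U_sets G_sets N.finite_measure_Diff[of U G] by (simp add: spN)
  also have "\<dots> \<le> measure N G + measure N (U - F)"
    using FU U_sets G_sets F_sets by (intro add_mono N.finite_measure_mono) (auto simp: spN)
  also have "measure N G \<le> measure M E"
  proof -
    have "emeasure N G \<le> emeasure M E"
      unfolding G(3)[symmetric] N[OF G_sets] using G_sets by (intro emeasure_mono) auto
    then show ?thesis
      using finE by (auto simp: measure_def intro!: enn2real_mono)
  qed
  finally have "measure N U \<le> 2 * measure M E"
    using FU(5) by simp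
  then have "emeasure N U \<le> ennreal (2 * measure M E)"
    by (simp add: N.emeasure_eq_measure)
  also have "\<dots> = 2 * emeasure M E"
    using finE by (simp add: ennreal_mult emeasure_eq_ennreal_measure)
  finally have "emeasure M (W \<inter> U) \<le> 2 * emeasure M E"
    using N[OF U_sets] by simp
  then show ?thesis
    using that[of "W \<inter> U"] quasi_open_Int[OF W(1) FU(2)] E(2) G(2) FU(4) by blast
qed

text \<open>Sigma-finiteness provides sets of finite measure that need not be open, whereas
  \<open>outer_regular\<close> works inside an open one. Interiors of countably many balls of radius
  \<open>r0\<close> serve instead.\<close>

lemma open_finite_cover:
  obtains W :: "nat \<Rightarrow> 'a set" where "\<And>i. quasi_open (space M) d (W i)"
    "\<And>i. emeasure M (W i) < \<infinity>" "(\<Union>i. W i) = space M"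
proof -
  \<comment> \<open>One factor \<open>2 * A\<close> is spent on the Vitali dilation, with all radii
    equal to \<open>R\<close>; the other places the dilated ball inside the interior of the ball of
    radius \<open>r0\<close>.\<close>
  define R where "R = r0 / (2 * A) / (2 * A)"
  have R: "0 < R" "2 * A * R = r0 / (2 * A)" "R \<le> r0"
  proof -
    have "R \<le> r0 / 1 / 1"
      unfolding R_def using ge_1 r0_pos by (intro frac_le) auto
    then show "0 < R" "2 * A * R = r0 / (2 * A)" "R \<le> r0"
      using ge_1 r0_pos by (simp_all add: R_def)
  qed
  obtain S where S: "S \<subseteq> space M" "disjoint_family_on (\<lambda>x. qball (space M) d x R) S"
    "space M \<subseteq> (\<Union>z\<in>S. qball (space M) d z (r0 / (2 * A)))"
    using Vitali_covering[of "space M" R "\<lambda>_. 0"] R by auto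
  have "countable S"
    using S qball_sets qball_pos R by (intro countable_disjoint_positive[OF S(2)]) auto
  have "S \<noteq> {}"
    using nonempty S by auto
  define W where "W i = qinterior (qball (space M) d (from_nat_into S i) r0)" for i
  have S_space: "from_nat_into S i \<in> space M" for i
    using from_nat_into[OF \<open>S \<noteq> {}\<close>] S by blast
  show ?thesis
  proof
    show W: "quasi_open (space M) d (W i)" for i
      unfolding W_def by (rule quasi_open_qinterior)
    show "emeasure M (W i) < \<infinity>" for i
      unfolding W_def
      using emeasure_mono[OF qinterior_subset qball_sets[OF S_space]]
        qball_finite[OF S_space r0_pos order_refl] by (rule order.strict_trans1)
    have "x \<in> (\<Union>i. W i)" if x: "x \<in> space M" for x
    proof -
      obtain z where z: "z \<in> S" "x \<in> qball (space M) d z (r0 / (2 * A))"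
        using subsetD[OF S(3) x] by auto
      then have "x \<in> qinterior (qball (space M) d z r0)"
        using half_qball_subset_qinterior[of z r0] S r0_pos by blast
      then have "x \<in> W (to_nat_on S z)"
        using z \<open>countable S\<close> by (simp add: W_def)
      then show ?thesis
        by blast
    qed
    then show "(\<Union>i. W i) = space M"
      using quasi_open_subset[OF W] by blast
  qed
qed

text \<open>Each point of \<open>E\<close> gets a dyadic ball inside an open \<open>U\<close> of
  measure at most twice that of \<open>E\<close>. The disjoint Vitali balls \<open>b\<close> stay in
  \<open>U\<close>, and their dilates \<open>B\<close> cover \<open>E\<close>, so doubling bounds
  the total measure of the dilates by \<open>D\<close> times that of \<open>U\<close>.\<close>

lemma ball_cover:
  assumes W: "quasi_open (space M) d W" "emeasure M W < \<infinity>"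
    and E: "E \<in> sets M" "E \<subseteq> W"
  shows "\<exists>P B :: nat \<Rightarrow> 'a set. (\<forall>j. P j \<in> sets M \<and> P j \<subseteq> B j \<and> (B j = {} \<or> good_ball M d (B j))) \<and>
    disjoint_family P \<and> (\<Union>j. P j) \<subseteq> E \<and> E - (\<Union>j. P j) \<in> null_sets M \<and>
    (\<Sum>j. emeasure M (B j)) \<le> ennreal (2 * D) * emeasure M E"
proof (cases "emeasure M E = 0")
  case True
  \<comment> \<open>Good balls have positive measure, so a null \<open>E\<close> gets empty sets
    only and is itself the exceptional null set.\<close>
  then show ?thesis
    using E by (intro exI[of _ "\<lambda>_. {}"]) (auto simp: disjoint_family_on_def)
next
  case False
  then have pos: "0 < emeasure M E"
    by (simp add: zero_less_iff_neq_zero)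
  obtain U where U: "quasi_open (space M) d U" "E \<subseteq> U" "emeasure M U \<le> 2 * emeasure M E"
    using outer_regular[OF W E pos] .
  \<comment> \<open>The largest radius whose dilate by \<open>2 * A\<close> still lies in the range
    where doubling is available.\<close>
  define R where "R = r0 / (2 * A)"
  have R: "0 < R" "2 * A * R = r0"
    using ge_1 r0_pos by (simp_all add: R_def)
  have "\<exists>n. qball (space M) d x (R / 2 ^ n) \<subseteq> U" if x: "x \<in> E" for x
  proof -
    obtain r where r: "0 < r" "qball (space M) d x r \<subseteq> U"
      using quasi_openE[OF U(1)] U(2) x by blast
    have "(\<lambda>n. R / 2 ^ n) \<longlonglongrightarrow> 0"
      by (intro LIMSEQ_divide_realpow_zero) simp
    then have "eventually (\<lambda>n. R / 2 ^ n < r) sequentially"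
      using r by (intro order_tendstoD(2))
    then obtain n where "R / 2 ^ n < r"
      by (auto simp: eventually_sequentially)
    then have "qball (space M) d x (R / 2 ^ n) \<subseteq> qball (space M) d x r"
      by (auto simp: qball_def)
    with r show ?thesis
      by blast
  qed
  then obtain k where k: "\<And>x. x \<in> E \<Longrightarrow> qball (space M) d x (R / 2 ^ k x) \<subseteq> U"
    by metis
  define b where "b x = qball (space M) d x (R / 2 ^ k x)" for x
  define B where "B x = qball (space M) d x (2 * A * (R / 2 ^ k x))" for x
  have E_sub: "E \<subseteq> space M"
    using E(1) by (rule sets.sets_into_space)
  obtain S where S: "S \<subseteq> E" "disjoint_family_on b S" "E \<subseteq> (\<Union>z\<in>S. B z)"
    using Vitali_covering[OF E_sub R(1), of k] unfolding b_def B_def by blast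
  have scale: "2 * A * (R / 2 ^ n) \<le> r0" "R / 2 ^ n \<le> r0" for n :: nat
  proof -
    have "r0 / 2 ^ n \<le> r0 / 1"
      using r0_pos by (intro divide_left_mono) auto
    then show 1: "2 * A * (R / 2 ^ n) \<le> r0"
      using R by (simp add: mult.assoc[symmetric])
    have "1 * (R / 2 ^ n) \<le> 2 * A * (R / 2 ^ n)"
      using ge_1 R by (intro mult_right_mono) auto
    with 1 show "R / 2 ^ n \<le> r0"
      by simp
  qed
  have b_sets: "b z \<in> sets M" and b_pos: "0 < emeasure M (b z)"
    and B_good: "good_ball M d (B z)" and B_le: "emeasure M (B z) \<le> ennreal D * emeasure M (b z)"
    if "z \<in> S" for z
    unfolding b_def B_def using that S E_sub R ge_1 scale
    by (auto intro!: qball_sets qball_pos good_ball_small doubling simp del: times_divide_eq_right)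
  have "countable S"
    using countable_disjoint_positive[OF S(2)] b_sets b_pos by blast
  have "S \<noteq> {}"
    using S pos by auto
  \<comment> \<open>For finite \<open>S\<close> the enumeration \<open>from_nat_into S\<close>
    repeats elements. Indices outside \<open>J\<close> receive the empty set, so each centre is
    counted once.\<close>
  define J where "J = to_nat_on S ` S"
  define z where "z j = from_nat_into S j" for j
  have z: "z j \<in> S" for j
    unfolding z_def using \<open>S \<noteq> {}\<close> by (rule from_nat_into)
  have z_inj: "j = j'" if "j \<in> J" "j' \<in> J" "z j = z j'" for j j'
    using that \<open>countable S\<close> unfolding J_def z_def by (metis imageE from_nat_into_to_nat_on)
  define b' where "b' j = (if j \<in> J then b (z j) else {})" for j
  define B' where "B' j = (if j \<in> J then B (z j) else {})" for j
  define P where "P j = E \<inter> disjointed B' j" for j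
  have B'_sets: "B' j \<in> sets M" for j
    using B_good z by (auto simp: B'_def good_ball_def)
  have b'_sets: "b' j \<in> sets M" for j
    using b_sets z by (auto simp: b'_def)
  have "P j \<in> sets M" for j
    unfolding P_def using E(1) B'_sets
    by (metis sets.Int sets.range_disjointed_sets image_subset_iff rangeI UNIV_I)
  moreover have "P j \<subseteq> B' j" for j
    unfolding P_def using disjointed_subset by fastforce
  moreover have "B' j = {} \<or> good_ball M d (B' j)" for j
    using B_good z by (auto simp: B'_def)
  moreover have "disjoint_family P"
    unfolding P_def using disjoint_family_disjointed[of B'] unfolding disjoint_family_on_def by blast
  moreover have PE: "(\<Union>j. P j) = E"
  proof -
    have "E \<subseteq> (\<Union>j. B' j)"
    proof
      fix x assume "x \<in> E"
      then obtain w where "w \<in> S" "x \<in> B w"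
        using S by blast
      then have "x \<in> B' (to_nat_on S w)"
        using \<open>countable S\<close> by (simp add: B'_def J_def z_def)
      then show "x \<in> (\<Union>j. B' j)"
        by blast
    qed
    then show ?thesis
      unfolding P_def using UN_disjointed_eq[of B'] by blast
  qed
  moreover have "(\<Sum>j. emeasure M (B' j)) \<le> ennreal (2 * D) * emeasure M E"
  proof -
    have "(\<Sum>j. emeasure M (B' j)) \<le> (\<Sum>j. ennreal D * emeasure M (b' j))"
      using B_le z by (intro suminf_le) (auto simp: B'_def b'_def)
    also have "\<dots> = ennreal D * (\<Sum>j. emeasure M (b' j))"
      by (rule ennreal_suminf_cmult)
    also have "(\<Sum>j. emeasure M (b' j)) = emeasure M (\<Union>j. b' j)"
    proof (rule suminf_emeasure)
      show "disjoint_family b'"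
        unfolding disjoint_family_on_def
      proof (intro ballI impI)
        fix i j :: nat assume "i \<noteq> j"
        then have "z i \<noteq> z j" if "i \<in> J" "j \<in> J"
          using z_inj that by blast
        then show "b' i \<inter> b' j = {}"
          using disjoint_family_onD[OF S(2) z z] by (simp add: b'_def)
      qed
    qed (use b'_sets in auto)
    also have "\<dots> \<le> emeasure M U"
      using k z S(1) quasi_open_sets[OF U(1)]
      by (intro emeasure_mono) (auto simp: b'_def b_def split: if_splits)
    also note U(3)
    also have "ennreal D * (2 * emeasure M E) = ennreal (2 * D) * emeasure M E"
      using D_pos by (simp add: ennreal_mult mult_ac)
    finally show ?thesis
      by (simp add: mult_left_mono)
  qed
  ultimately show ?thesis
    by (intro exI[of _ P] exI[of _ B']) auto
qed

end

section \<open>Blocks\<close>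

lemma one_less_ennreal_cases:
  fixes q :: ennreal
  assumes "1 < q"
  obtains "q = \<infinity>" | p where "q = ennreal p" "1 < p"
  using assms by (cases q) auto

lemma conj_exponent_ennreal:
  assumes "1 < p"
  shows "1 / conj_exponent (ennreal p) = 1 - 1 / p"
  using assms by (simp add: conj_exponent_def field_simps)

lemma conj_exponent_top: "conj_exponent top = 1"
  by (simp add: conj_exponent_def)

text \<open>On a space of mass \<open>m\<close> the constant \<open>1 / m\<close> has norm
  \<open>m powr (1 / q - 1)\<close>, with \<open>1 / q = 0\<close> for infinite \<open>q\<close>.
  This is exactly the threshold in the definition of a block.\<close>

lemma Lq_norm_bounded_le:
  assumes "finite_measure N" and a[measurable]: "a \<in> borel_measurable N"
    and m: "0 < measure N (space N)"
    and bound: "\<And>x. x \<in> space N \<Longrightarrow> norm (a x) \<le> 1 / measure N (space N)"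
    and q: "1 < q"
  shows "Lq_norm N q a \<le> ennreal (measure N (space N) powr - (1 / conj_exponent q))"
proof -
  interpret finite_measure N by fact
  define m where "m = measure N (space N)"
  have m: "0 < m"
    using m by (simp add: m_def)
  note bound = bound[folded m_def]
  from q have "Lq_norm N q a \<le> ennreal (m powr - (1 / conj_exponent q))"
  proof (cases rule: one_less_ennreal_cases)
    case 1
    have "esssup N (\<lambda>x. ennreal (norm (a x))) \<le> ennreal (1 / m)"
      using bound by (intro esssup_I) (auto intro!: ennreal_leI)
    then show ?thesis
      using m by (simp add: 1 Lq_norm_def conj_exponent_top powr_minus_divide)
  next
    case (2 p)
    define I where "I = (\<integral>\<^sup>+x. ennreal (norm (a x) powr p) \<partial>N)"
    have "I \<le> (\<integral>\<^sup>+x. ennreal ((1 / m) powr p) \<partial>N)"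
      unfolding I_def using bound 2 by (intro nn_integral_mono ennreal_leI powr_mono2) auto
    also have "\<dots> = ennreal ((1 / m) powr p * m)"
      by (simp add: emeasure_eq_measure m_def ennreal_mult)
    also have "(1 / m) powr p * m = m powr (1 - p)"
      using m by (simp add: powr_divide powr_diff)
    finally have I: "I \<le> ennreal (m powr (1 - p))" .
    then have "I \<noteq> \<infinity>"
      by (auto simp: top_unique)
    have "enn2real I powr (1 / p) \<le> (m powr (1 - p)) powr (1 / p)"
      using I 2 by (intro powr_mono2 enn2real_leI) auto
    also have "\<dots> = m powr - (1 - 1 / p)"
      using 2 by (simp add: powr_powr diff_divide_distrib)
    finally show ?thesis
      using 2 \<open>I \<noteq> \<infinity>\<close>
      by (simp add: Lq_norm_def conj_exponent_ennreal I_def Let_def ennreal_leI)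
  qed
  then show ?thesis
    by (simp add: m_def)
qed

text \<open>Hoelder's inequality against a constant; pointwise it is Young's inequality applied to
  \<open>m * norm (a x)\<close> and \<open>1\<close>, where \<open>m\<close> is the total mass.\<close>

lemma nn_integral_norm_le_1:
  assumes "finite_measure N" and a[measurable]: "a \<in> borel_measurable N"
    and m: "0 < measure N (space N)"
    and bound: "Lq_norm N q a \<le> ennreal (measure N (space N) powr - (1 / conj_exponent q))"
    and q: "1 < q"
  shows "(\<integral>\<^sup>+x. ennreal (norm (a x)) \<partial>N) \<le> 1"
proof -
  interpret finite_measure N by fact
  define m where "m = measure N (space N)"
  have m: "0 < m"
    using m by (simp add: m_def)
  note bound = bound[folded m_def]
  from q show ?thesis
  proof (cases rule: one_less_ennreal_cases)
    case 1
    have "esssup N (\<lambda>x. ennreal (norm (a x))) \<le> ennreal (1 / m)"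
      using bound m by (simp add: 1 Lq_norm_def conj_exponent_top powr_minus_divide)
    then have "AE x in N. ennreal (norm (a x)) \<le> ennreal (1 / m)"
      using esssup_AE[where M = N and f = "\<lambda>x. ennreal (norm (a x))"] by (auto elim!: eventually_mono)
    then have "(\<integral>\<^sup>+x. ennreal (norm (a x)) \<partial>N) \<le> (\<integral>\<^sup>+x. ennreal (1 / m) \<partial>N)"
      by (rule nn_integral_mono_AE)
    also have "\<dots> = 1"
      using m by (simp add: emeasure_eq_measure m_def[symmetric] ennreal_mult[symmetric])
    finally show ?thesis .
  next
    case (2 p)
    define I where "I = (\<integral>\<^sup>+x. ennreal (norm (a x) powr p) \<partial>N)"
    have "I \<noteq> \<infinity>" and "enn2real I powr (1 / p) \<le> m powr - (1 - 1 / p)"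
      using 2 bound by (auto simp: Lq_norm_def conj_exponent_ennreal I_def Let_def top_unique split: if_splits)
    then have "(enn2real I powr (1 / p)) powr p \<le> (m powr - (1 - 1 / p)) powr p"
      using 2 by (intro powr_mono2) auto
    moreover have "- (1 - 1 / p) * p = 1 - p"
      using 2 by (simp add: algebra_simps)
    then have "(m powr - (1 - 1 / p)) powr p = m powr (1 - p)"
      by (simp only: powr_powr)
    ultimately have "enn2real I \<le> m powr (1 - p)"
      using 2 by (simp add: powr_powr)
    then have I: "I \<le> ennreal (m powr (1 - p))"
      using \<open>I \<noteq> \<infinity>\<close> by (metis ennreal_leI ennreal_enn2real infinity_ennreal_def top.not_eq_extremum)
    have young: "norm (a x) \<le> m powr (p - 1) / p * norm (a x) powr p + (1 - 1 / p) / m" for x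
    proof -
      have "(m * norm (a x)) * 1 \<le> (m * norm (a x)) powr p / p + 1 powr (p / (p - 1)) / (p / (p - 1))"
        using 2 m by (intro Youngs_inequality) (auto simp: field_simps)
      then have "m * norm (a x) \<le> m * m powr (p - 1) * norm (a x) powr p / p + (1 - 1 / p)"
        using 2 m by (simp add: powr_mult powr_diff diff_divide_distrib)
      also have "\<dots> = m * (m powr (p - 1) / p * norm (a x) powr p + (1 - 1 / p) / m)"
        using m by (simp add: distrib_left)
      finally show ?thesis
        using m by simp
    qed
    have "(\<integral>\<^sup>+x. ennreal (norm (a x)) \<partial>N) \<le>
        (\<integral>\<^sup>+x. ennreal (m powr (p - 1) / p) * ennreal (norm (a x) powr p) + ennreal ((1 - 1 / p) / m) \<partial>N)"
      using 2 m young
      by (intro nn_integral_mono) (simp add: ennreal_mult[symmetric] ennreal_plus[symmetric] del: ennreal_plus)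
    also have "\<dots> = ennreal (m powr (p - 1) / p) * I + ennreal ((1 - 1 / p) / m) * ennreal m"
      by (simp add: nn_integral_add nn_integral_cmult I_def emeasure_eq_measure m_def)
    also have "\<dots> \<le> ennreal (m powr (p - 1) / p) * ennreal (m powr (1 - p)) + ennreal ((1 - 1 / p) / m) * ennreal m"
      using I by (intro add_mono mult_left_mono) auto
    also have "\<dots> = ennreal (m powr (p - 1) / p * m powr (1 - p)) + ennreal ((1 - 1 / p) / m * m)"
      using 2 m by (intro arg_cong2[where f = "(+)"] ennreal_mult[symmetric]) auto
    also have "\<dots> = ennreal (m powr (p - 1) / p * m powr (1 - p) + (1 - 1 / p) / m * m)"
      using 2 m by (intro ennreal_plus[symmetric]) auto
    \<comment> \<open>The two terms of Young's inequality contribute their weights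
      \<open>1 / p\<close> and \<open>1 - 1 / p\<close>.\<close>
    also have "m powr (p - 1) / p * m powr (1 - p) + (1 - 1 / p) / m * m = 1"
      using 2 m by (simp add: powr_add[symmetric] field_simps)
    finally show ?thesis
      by simp
  qed
qed

section \<open>From norm bounds on a ball to blocks on the whole space\<close>

lemma Lq_norm_1: "Lq_norm M 1 g = (\<integral>\<^sup>+x. ennreal (norm (g x)) \<partial>M)"
  by (auto simp: Lq_norm_def Let_def top.not_eq_extremum)

lemma finite_measure_restrict_space:
  assumes "B \<in> sets M" "emeasure M B < \<infinity>"
  shows "finite_measure (restrict_space M B)" "space (restrict_space M B) = B"
    "measure (restrict_space M B) (space (restrict_space M B)) = measure M B"
proof -
  have sp: "space (restrict_space M B) = B"
    using sets.sets_into_space[OF assms(1)] by (auto simp: space_restrict_space)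
  then show "finite_measure (restrict_space M B)"
    using assms by (intro finite_measureI) (simp add: emeasure_restrict_space)
  show "space (restrict_space M B) = B"
    by (rule sp)
  show "measure (restrict_space M B) (space (restrict_space M B)) = measure M B"
    unfolding sp using assms by (simp add: measure_restrict_space)
qed

text \<open>A single pointwise bound serves every exponent, so decompositions can be built without
  reference to \<open>q\<close>.\<close>

lemma is_block_bounded:
  assumes B: "good_ball M d B" and a: "a \<in> borel_measurable M"
    and zero: "\<And>x. x \<in> space M - B \<Longrightarrow> a x = 0"
    and bound: "\<And>x. x \<in> B \<Longrightarrow> norm (a x) \<le> 1 / measure M B"
    and q: "1 < q"
  shows "is_block M d q 0 a"
proof -
  obtain x t where xt: "x \<in> space M" "0 < t" "B = qball (space M) d x t"
    and Bs: "B \<in> sets M" "0 < emeasure M B" "emeasure M B < \<infinity>"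
    using B by (auto simp: good_ball_def)
  note N = finite_measure_restrict_space[OF Bs(1,3)]
  have "0 < measure M B"
    using Bs by (simp add: measure_def enn2real_positive_iff)
  then have "Lq_norm (restrict_space M B) q a \<le> ennreal (measure M B powr - (1 / conj_exponent q))"
    using Lq_norm_bounded_le[OF N(1) measurable_restrict_space1[OF a] _ _ q] bound N by simp
  then show ?thesis
    unfolding is_block_def Let_def using a zero xt Bs by (auto intro!: bexI[of _ x] exI[of _ t])
qed

text \<open>With \<alpha> = 0 the radius drops out of the block bound, and Hoelder's inequality on
  the supporting ball gives a constant independent of the ball.\<close>

lemma nn_integral_block_le_1:
  assumes balls: "\<And>x r. x \<in> space M \<Longrightarrow> qball (space M) d x r \<in> sets M"
    and a: "is_block M d q 0 a" and q: "1 < q"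
  shows "(\<integral>\<^sup>+x. ennreal (norm (a x)) \<partial>M) \<le> 1"
proof -
  obtain x t where xt: "x \<in> space M" "0 < t" "0 < emeasure M (qball (space M) d x t)"
      "emeasure M (qball (space M) d x t) < \<infinity>"
      "\<And>y. y \<in> space M - qball (space M) d x t \<Longrightarrow> a y = 0"
      "Lq_norm (restrict_space M (qball (space M) d x t)) q a \<le>
        ennreal (measure M (qball (space M) d x t) powr - (1 / conj_exponent q))"
    and am: "a \<in> borel_measurable M"
    using a by (auto simp: is_block_def Let_def)
  define B where "B = qball (space M) d x t"
  note B = xt(3-6)[folded B_def]
  have Bs: "B \<in> sets M"
    unfolding B_def by (intro balls xt)
  note N = finite_measure_restrict_space[OF Bs B(2)]
  have "0 < measure M B"
    using B by (simp add: measure_def enn2real_positive_iff)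
  then have "(\<integral>\<^sup>+x. ennreal (norm (a x)) \<partial>restrict_space M B) \<le> 1"
    using nn_integral_norm_le_1[OF N(1) measurable_restrict_space1[OF am] _ _ q] B N by simp
  also have "(\<integral>\<^sup>+x. ennreal (norm (a x)) \<partial>restrict_space M B) =
      (\<integral>\<^sup>+x. ennreal (norm (a x)) * indicator B x \<partial>M)"
    using Bs by (intro nn_integral_restrict_space) simp
  also have "\<dots> = (\<integral>\<^sup>+x. ennreal (norm (a x)) \<partial>M)"
    using B(3) by (intro nn_integral_cong) (auto split: split_indicator)
  finally show ?thesis .
qed

text \<open>Every partial sum has integral norm at most the coefficient sum, because each block
  contributes at most 1. The triangle inequality passes this bound to \<open>f\<close>, as the
  remainder tends to 0.\<close>

lemma block_decomposition_L1_le: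
  assumes balls: "\<And>x r. x \<in> space M \<Longrightarrow> qball (space M) d x r \<in> sets M"
    and dec: "block_decomposition M d q 0 f l a" and q: "1 < q" and f: "integrable M f"
  shows "L1_norm M f \<le> (\<Sum>j. norm (l j))"
proof -
  define S where "S n x = (\<Sum>j<n. l j * a j x)" for n x
  have block: "is_block M d q 0 (a j)" and summable: "summable (\<lambda>j. norm (l j))"
    and lim: "(\<lambda>n. Lq_norm M 1 (\<lambda>x. f x - S n x)) \<longlonglongrightarrow> 0" for j
    using dec by (auto simp: block_decomposition_def S_def)
  have [measurable]: "a j \<in> borel_measurable M" for j
    using block[of j] by (simp add: is_block_def)
  have [measurable]: "f \<in> borel_measurable M"
    using f by auto
  have [measurable]: "S n \<in> borel_measurable M" for n
    unfolding S_def by measurable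
  have S_le: "(\<integral>\<^sup>+x. ennreal (norm (S n x)) \<partial>M) \<le> ennreal (\<Sum>j. norm (l j))" for n
  proof -
    have "(\<integral>\<^sup>+x. ennreal (norm (S n x)) \<partial>M) \<le>
        (\<integral>\<^sup>+x. (\<Sum>j<n. ennreal (norm (l j)) * ennreal (norm (a j x))) \<partial>M)"
    proof (intro nn_integral_mono)
      fix x
      have "norm (S n x) \<le> (\<Sum>j<n. norm (l j) * norm (a j x))"
        unfolding S_def by (rule order_trans[OF norm_sum]) (simp add: norm_mult)
      then show "ennreal (norm (S n x)) \<le> (\<Sum>j<n. ennreal (norm (l j)) * ennreal (norm (a j x)))"
        by (simp add: ennreal_mult[symmetric] sum_ennreal ennreal_leI)
    qed
    also have "\<dots> = (\<Sum>j<n. ennreal (norm (l j)) * (\<integral>\<^sup>+x. ennreal (norm (a j x)) \<partial>M))"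
      by (simp add: nn_integral_sum nn_integral_cmult)
    also have "\<dots> \<le> (\<Sum>j<n. ennreal (norm (l j)) * 1)"
      by (intro sum_mono mult_left_mono nn_integral_block_le_1[OF balls block q]) auto
    also have "\<dots> = ennreal (\<Sum>j<n. norm (l j))"
      by (simp add: sum_ennreal)
    also have "\<dots> \<le> ennreal (\<Sum>j. norm (l j))"
      by (intro ennreal_leI sum_le_suminf summable) auto
    finally show ?thesis .
  qed
  have "(\<integral>\<^sup>+x. ennreal (norm (f x)) \<partial>M) \<le>
      Lq_norm M 1 (\<lambda>x. f x - S n x) + ennreal (\<Sum>j. norm (l j))" for n
  proof -
    have "(\<integral>\<^sup>+x. ennreal (norm (f x)) \<partial>M) \<le>
        (\<integral>\<^sup>+x. ennreal (norm (f x - S n x)) + ennreal (norm (S n x)) \<partial>M)"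
    proof (intro nn_integral_mono)
      fix x
      have "norm (f x) \<le> norm (f x - S n x) + norm (S n x)"
        using norm_triangle_ineq[of "f x - S n x" "S n x"] by simp
      then show "ennreal (norm (f x)) \<le> ennreal (norm (f x - S n x)) + ennreal (norm (S n x))"
        by (simp add: ennreal_plus[symmetric] ennreal_leI del: ennreal_plus)
    qed
    also have "\<dots> = Lq_norm M 1 (\<lambda>x. f x - S n x) + (\<integral>\<^sup>+x. ennreal (norm (S n x)) \<partial>M)"
      by (simp add: nn_integral_add Lq_norm_1)
    also have "\<dots> \<le> Lq_norm M 1 (\<lambda>x. f x - S n x) + ennreal (\<Sum>j. norm (l j))"
      by (intro add_left_mono S_le)
    finally show ?thesis .
  qed
  moreover have "(\<lambda>n. Lq_norm M 1 (\<lambda>x. f x - S n x) + ennreal (\<Sum>j. norm (l j)))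
      \<longlonglongrightarrow> 0 + ennreal (\<Sum>j. norm (l j))"
    by (intro tendsto_add lim tendsto_const)
  ultimately have "(\<integral>\<^sup>+x. ennreal (norm (f x)) \<partial>M) \<le> ennreal (\<Sum>j. norm (l j))"
    by (intro LIMSEQ_le_const[where x = "ennreal (\<Sum>j. norm (l j))"]) auto
  moreover have "(\<integral>\<^sup>+x. ennreal (norm (f x)) \<partial>M) = ennreal (L1_norm M f)"
    unfolding L1_norm_def using f by (intro nn_integral_eq_integral) auto
  ultimately show ?thesis
    using summable by (simp add: suminf_nonneg)
qed

section \<open>Block decompositions of integrable functions\<close>

context locally_doubling_space
begin

text \<open>\<open>ball_cover\<close> is applied to each dyadic level set, cut further into pieces
  of finite measure. The constant \<open>4 * D\<close> is the covering constant \<open>2 * D\<close>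
  times 2, because \<open>h\<close> exceeds the modulus of \<open>f\<close> by at most a factor 2 on
  each level set.\<close>

lemma level_set_cover:
  assumes f: "integrable M f"
  obtains P B :: "nat \<Rightarrow> 'a set" and h :: "nat \<Rightarrow> real"
  where "\<And>n. P n \<in> sets M" "\<And>n. P n \<subseteq> B n" "\<And>n. B n = {} \<or> good_ball M d (B n)"
    "disjoint_family P" "AE x in M. f x \<noteq> 0 \<longrightarrow> x \<in> (\<Union>n. P n)"
    "\<And>n. 0 < h n" "\<And>n x. x \<in> P n \<Longrightarrow> norm (f x) \<le> h n"
    "(\<Sum>n. ennreal (h n) * emeasure M (B n)) \<le> ennreal (4 * D) * (\<integral>\<^sup>+x. ennreal (norm (f x)) \<partial>M)"
proof -
  have f_meas [measurable]: "f \<in> borel_measurable M"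
    using f by auto
  obtain W :: "nat \<Rightarrow> 'a set" where W: "\<And>i. quasi_open (space M) d (W i)"
    "\<And>i. emeasure M (W i) < \<infinity>" "(\<Union>i. W i) = space M"
    using open_finite_cover by blast
  \<comment> \<open>Level \<open>k\<close> means that the modulus of \<open>f\<close> lies above
    \<open>2 powr (k - 1)\<close> and not above \<open>2 powr k\<close>. Levels may be negative,
    hence the integer coding in \<open>k\<close>. Zeros of \<open>f\<close>, where the logarithm
    carries no meaning, are excluded from \<open>E\<close>.\<close>
  define lev where "lev x = \<lceil>log 2 (norm (f x))\<rceil>" for x
  define k where "k m = int_decode (fst (prod_decode m))" for m
  define i where "i m = snd (prod_decode m)" for m
  \<comment> \<open>The index \<open>m\<close> codes a pair of a level and a member of the open
    cover. Disjointing the cover keeps the pieces disjoint and each of them inside one open set of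
    finite measure.\<close>
  define E where "E m = {x \<in> space M. f x \<noteq> 0 \<and> lev x = k m} \<inter> disjointed W (i m)" for m
  define h where "h m = 2 powr real_of_int (k m)" for m
  have W_sets: "W n \<in> sets M" for n
    by (rule quasi_open_sets[OF W(1)])
  have "disjointed W n \<in> sets M" for n
    using sets.range_disjointed_sets[of W M] W_sets by blast
  moreover have [measurable]: "lev \<in> measurable M (count_space UNIV)"
    unfolding lev_def by measurable
  ultimately have E_sets: "E m \<in> sets M" for m
    unfolding E_def by (intro sets.Int) measurable
  have E_W: "E m \<subseteq> W (i m)" for m
    unfolding E_def using disjointed_subset[of W] by blast
  have E_upper: "norm (f x) \<le> h m" and E_lower: "h m \<le> 2 * norm (f x)" if "x \<in> E m" for x m
  proof -
    have pos: "0 < norm (f x)" and lev: "lev x = k m"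
      using that by (auto simp: E_def)
    have "log 2 (norm (f x)) \<le> k m" "k m < log 2 (norm (f x)) + 1"
      unfolding lev[symmetric] lev_def by linarith+
    then have "2 powr log 2 (norm (f x)) \<le> h m" "h m \<le> 2 powr (log 2 (norm (f x)) + 1)"
      unfolding h_def by (auto intro!: powr_mono)
    then show "norm (f x) \<le> h m" "h m \<le> 2 * norm (f x)"
      using pos by (simp_all add: powr_add)
  qed
  have E_disj: "disjoint_family E"
    unfolding disjoint_family_on_def
  proof (intro ballI impI)
    fix m n :: nat assume "m \<noteq> n"
    then have "fst (prod_decode m) \<noteq> fst (prod_decode n) \<or> i m \<noteq> i n"
      unfolding i_def by (metis prod_eq_iff prod_decode_inverse)
    then consider "k m \<noteq> k n" | "i m \<noteq> i n"
      unfolding k_def by (metis int_decode_inverse)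
    then show "E m \<inter> E n = {}"
    proof cases
      case 2
      then have "disjointed W (i m) \<inter> disjointed W (i n) = {}"
        using disjoint_family_disjointed[of W] by (simp add: disjoint_family_on_def)
      then show ?thesis
        by (auto simp: E_def)
    qed (auto simp: E_def)
  qed
  have E_cover: "\<exists>m. x \<in> E m" if x: "x \<in> space M" "f x \<noteq> 0" for x
  proof -
    obtain j where "x \<in> disjointed W j"
      using x W(3) UN_disjointed_eq[of W] by blast
    then have "x \<in> E (prod_encode (int_encode (lev x), j))"
      using x by (simp add: E_def k_def i_def)
    then show ?thesis ..
  qed
  have "\<forall>m. \<exists>P B :: nat \<Rightarrow> 'a set.
    (\<forall>j. P j \<in> sets M \<and> P j \<subseteq> B j \<and> (B j = {} \<or> good_ball M d (B j))) \<and>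
    disjoint_family P \<and> (\<Union>j. P j) \<subseteq> E m \<and> E m - (\<Union>j. P j) \<in> null_sets M \<and>
    (\<Sum>j. emeasure M (B j)) \<le> ennreal (2 * D) * emeasure M (E m)"
    using ball_cover[OF W(1,2) E_sets E_W] by blast
  then obtain P B :: "nat \<Rightarrow> nat \<Rightarrow> 'a set"
    where P_sets: "\<And>m j. P m j \<in> sets M" and PB: "\<And>m j. P m j \<subseteq> B m j"
      and B: "\<And>m j. B m j = {} \<or> good_ball M d (B m j)"
      and P_disj: "\<And>m. disjoint_family (P m)" and P_E: "\<And>m. (\<Union>j. P m j) \<subseteq> E m"
      and null: "\<And>m. E m - (\<Union>j. P m j) \<in> null_sets M"
      and B_sum: "\<And>m. (\<Sum>j. emeasure M (B m j)) \<le> ennreal (2 * D) * emeasure M (E m)"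
    by metis
  define P' where "P' n = case_prod P (prod_decode n)" for n
  define B' where "B' n = case_prod B (prod_decode n)" for n
  define h' where "h' n = h (fst (prod_decode n))" for n
  show ?thesis
  proof
    show "P' n \<in> sets M" "P' n \<subseteq> B' n" "B' n = {} \<or> good_ball M d (B' n)" "0 < h' n" for n
      using P_sets PB B by (auto simp: P'_def B'_def h'_def h_def split: prod.split)
    show "norm (f x) \<le> h' n" if "x \<in> P' n" for x n
      using that P_E[of "fst (prod_decode n)"] E_upper
      by (auto simp: P'_def h'_def split: prod.splits)
    show "disjoint_family P'"
      unfolding disjoint_family_on_def
    proof (intro ballI impI)
      fix n n' :: nat assume ne: "n \<noteq> n'"
      obtain m j m' j' where mj: "prod_decode n = (m, j)" "prod_decode n' = (m', j')"
        by fastforce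
      then have "(m, j) \<noteq> (m', j')"
        using ne by (metis prod_decode_inverse)
      moreover have "P m j \<subseteq> E m" "P m' j' \<subseteq> E m'"
        using P_E by blast+
      moreover have "E m \<inter> E m' = {}" if "m \<noteq> m'"
        using E_disj that by (simp add: disjoint_family_on_def)
      moreover have "P m j \<inter> P m j' = {}" if "j \<noteq> j'"
        using P_disj[of m] that by (simp add: disjoint_family_on_def)
      ultimately have "P m j \<inter> P m' j' = {}"
        by (cases "m = m'") auto
      then show "P' n \<inter> P' n' = {}"
        by (simp add: P'_def mj)
    qed
    show "AE x in M. f x \<noteq> 0 \<longrightarrow> x \<in> (\<Union>n. P' n)"
    proof (rule AE_I')
      show "(\<Union>m. E m - (\<Union>j. P m j)) \<in> null_sets M"
        using null by (rule null_sets_UN)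
      have "x \<in> (\<Union>m. E m - (\<Union>j. P m j))"
        if x: "x \<in> space M" "f x \<noteq> 0" "x \<notin> (\<Union>n. P' n)" for x
      proof -
        obtain m where m: "x \<in> E m"
          using E_cover x by blast
        have "P m j = P' (prod_encode (m, j))" for j
          by (simp add: P'_def)
        then show ?thesis
          using m x(3) by blast
      qed
      then show "{x \<in> space M. \<not> (f x \<noteq> 0 \<longrightarrow> x \<in> (\<Union>n. P' n))} \<subseteq> (\<Union>m. E m - (\<Union>j. P m j))"
        by blast
    qed
    have "(\<Sum>n. ennreal (h' n) * emeasure M (B' n)) =
        (\<Sum>n. (\<lambda>(m, j). ennreal (h m) * emeasure M (B m j)) (prod_decode n))"
      by (simp add: h'_def B'_def case_prod_beta)
    also have "\<dots> = (\<Sum>m. ennreal (h m) * (\<Sum>j. emeasure M (B m j)))"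
      by (rule suminf_ennreal_2dimen) simp
    \<comment> \<open>Writing the integrals of the modulus of \<open>f\<close> over
      \<open>E m\<close> as values of one measure with that density lets countable additivity sum
      them over the disjoint pieces.\<close>
    also have "\<dots> \<le> (\<Sum>m. ennreal (4 * D) * emeasure (density M (\<lambda>x. ennreal (norm (f x)))) (E m))"
    proof (intro suminf_le summableI)
      fix m
      have "ennreal (h m) * emeasure M (E m) = (\<integral>\<^sup>+x. ennreal (h m) * indicator (E m) x \<partial>M)"
        using E_sets by (simp add: nn_integral_cmult_indicator)
      also have "\<dots> \<le> (\<integral>\<^sup>+x. 2 * (ennreal (norm (f x)) * indicator (E m) x) \<partial>M)"
      proof (intro nn_integral_mono)
        fix x
        have "ennreal (h m) \<le> 2 * ennreal (norm (f x))" if "x \<in> E m"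
          using ennreal_leI[OF E_lower[OF that]] by (simp add: ennreal_mult)
        then show "ennreal (h m) * indicator (E m) x \<le> 2 * (ennreal (norm (f x)) * indicator (E m) x)"
          by (simp split: split_indicator)
      qed
      also have "\<dots> = 2 * emeasure (density M (\<lambda>x. ennreal (norm (f x)))) (E m)"
        using E_sets by (simp add: nn_integral_cmult emeasure_density)
      finally have E_le: "ennreal (h m) * emeasure M (E m) \<le>
          2 * emeasure (density M (\<lambda>x. ennreal (norm (f x)))) (E m)" .
      have "ennreal (h m) * (\<Sum>j. emeasure M (B m j)) \<le>
          ennreal (h m) * (ennreal (2 * D) * emeasure M (E m))"
        by (intro mult_left_mono B_sum) auto
      also have "\<dots> = ennreal (2 * D) * (ennreal (h m) * emeasure M (E m))"
        by (rule mult.left_commute)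
      also have "\<dots> \<le> ennreal (2 * D) * (2 * emeasure (density M (\<lambda>x. ennreal (norm (f x)))) (E m))"
        by (intro mult_left_mono E_le) auto
      also have "\<dots> = ennreal (2 * D) * 2 * emeasure (density M (\<lambda>x. ennreal (norm (f x)))) (E m)"
        by (rule mult.assoc[symmetric])
      also have "ennreal (2 * D) * 2 = ennreal (4 * D)"
        using D_pos ennreal_mult[of "2 * D" 2] by simp
      finally show "ennreal (h m) * (\<Sum>j. emeasure M (B m j)) \<le>
          ennreal (4 * D) * emeasure (density M (\<lambda>x. ennreal (norm (f x)))) (E m)" .
    qed
    also have "\<dots> = ennreal (4 * D) * emeasure (density M (\<lambda>x. ennreal (norm (f x)))) (\<Union>m. E m)"
      using E_sets E_disj by (subst suminf_emeasure[symmetric]) (auto intro: ennreal_suminf_cmult)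
    also have "\<dots> \<le> ennreal (4 * D) * (\<integral>\<^sup>+x. ennreal (norm (f x)) \<partial>M)"
      using E_sets
      by (intro mult_left_mono) (auto simp: emeasure_density intro!: nn_integral_mono split: split_indicator)
    finally show "(\<Sum>n. ennreal (h' n) * emeasure M (B' n)) \<le> \<dots>" .
  qed
qed

text \<open>The piece of \<open>f\<close> on \<open>P n\<close>, divided by \<open>h n\<close> times
  the measure of \<open>B n\<close>, is bounded by the reciprocal of that measure and hence is a
  block. The divisors are the coefficients, and their sum is controlled by
  \<open>level_set_cover\<close>.\<close>

lemma block_decomposition_exists:
  assumes f: "integrable M f" and q: "1 < q"
  obtains l a where "block_decomposition M d q 0 f l a" "(\<Sum>j. norm (l j)) \<le> 4 * D * L1_norm M f"
proof -
  have f_meas [measurable]: "f \<in> borel_measurable M"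
    using f by auto
  obtain P B :: "nat \<Rightarrow> 'a set" and h :: "nat \<Rightarrow> real"
    where P_sets [measurable]: "\<And>n. P n \<in> sets M" and PB: "\<And>n. P n \<subseteq> B n"
      and B: "\<And>n. B n = {} \<or> good_ball M d (B n)" and disj: "disjoint_family P"
      and cover: "AE x in M. f x \<noteq> 0 \<longrightarrow> x \<in> (\<Union>n. P n)"
      and h_pos: "\<And>n. 0 < h n" and h: "\<And>n x. x \<in> P n \<Longrightarrow> norm (f x) \<le> h n"
      and h_sum: "(\<Sum>n. ennreal (h n) * emeasure M (B n)) \<le>
        ennreal (4 * D) * (\<integral>\<^sup>+x. ennreal (norm (f x)) \<partial>M)"
    using level_set_cover[OF f] by blast
  have f_int: "(\<integral>\<^sup>+x. ennreal (norm (f x)) \<partial>M) = ennreal (L1_norm M f)"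
    unfolding L1_norm_def using f by (intro nn_integral_eq_integral) auto
  define c where "c n = h n * measure M (B n)" for n
  have c_nonneg: "0 \<le> c n" for n
    unfolding c_def using h_pos[of n] by simp
  have c_pos: "0 < c n" if "good_ball M d (B n)" for n
    using that h_pos[of n] by (simp add: c_def good_ball_def measure_def enn2real_positive_iff)
  define l where "l n = complex_of_real (c n)" for n
  define a where "a n x = (if x \<in> P n then f x / c n else 0)" for n x
  have block: "is_block M d q 0 (a n)" for n
  proof -
    have a_meas: "a n \<in> borel_measurable M"
      unfolding a_def by measurable
    show ?thesis
    proof (cases "B n = {}")
      \<comment> \<open>An empty \<open>B n\<close> has coefficient 0, but its term must still be a
        block. The zero function is one on any small ball.\<close>
      case True
      obtain x where "x \<in> space M"
        using nonempty by blast
      then have "good_ball M d (qball (space M) d x r0)"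
        using r0_pos by (intro good_ball_small) auto
      moreover have "a n y = 0" for y
        using True PB[of n] by (auto simp: a_def)
      ultimately show ?thesis
        using a_meas q by (intro is_block_bounded) auto
    next
      case False
      then have good: "good_ball M d (B n)"
        using B by blast
      then show ?thesis
      proof (rule is_block_bounded[OF _ a_meas _ _ q])
        show "a n x = 0" if "x \<in> space M - B n" for x
          using that PB[of n] by (auto simp: a_def)
        show "norm (a n x) \<le> 1 / measure M (B n)" for x
        proof (cases "x \<in> P n")
          case True
          have "norm (a n x) = norm (f x) / c n"
            using True c_nonneg by (simp add: a_def norm_divide)
          also have "\<dots> \<le> h n / c n"
            by (intro divide_right_mono h True c_nonneg)
          also have "\<dots> = 1 / measure M (B n)"
            using h_pos[of n] by (simp add: c_def)
          finally show ?thesis .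
        qed (simp add: a_def)
      qed
    qed
  qed
  have "(\<Sum>n. ennreal (c n)) = (\<Sum>n. ennreal (h n) * emeasure M (B n))"
  proof (intro arg_cong[where f = suminf] ext)
    fix n
    have "emeasure M (B n) = ennreal (measure M (B n))"
      using B[of n] by (auto simp: good_ball_def emeasure_eq_ennreal_measure)
    then show "ennreal (c n) = ennreal (h n) * emeasure M (B n)"
      using h_pos[of n] by (simp add: c_def ennreal_mult)
  qed
  also have "\<dots> \<le> ennreal (4 * D * L1_norm M f)"
    using h_sum D_pos by (simp add: f_int ennreal_mult L1_norm_def)
  finally have c_sum: "(\<Sum>n. ennreal (c n)) \<le> ennreal (4 * D * L1_norm M f)" .
  then have c_summable: "summable c"
    using c_nonneg by (intro summable_suminf_not_top) (auto simp: top_unique)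
  have sums_le: "suminf c \<le> 4 * D * L1_norm M f"
  proof -
    have "ennreal (suminf c) \<le> ennreal (4 * D * L1_norm M f)"
      using c_sum c_nonneg c_summable by (simp add: suminf_ennreal2)
    moreover have "0 \<le> 4 * D * L1_norm M f"
      using D_pos by (simp add: L1_norm_def)
    ultimately show ?thesis
      by simp
  qed
  have summand: "l n * a n x = (if x \<in> P n then f x else 0)" for n x
  proof (cases "x \<in> P n")
    case True
    then have "0 < c n"
      using c_pos PB B by blast
    then show ?thesis
      using True by (simp add: l_def a_def)
  qed (simp add: a_def)
  have partial: "(\<Sum>j<n. l j * a j x) = (if x \<in> (\<Union>j<n. P j) then f x else 0)" for n x
  proof (cases "x \<in> (\<Union>j<n. P j)")
    case True
    then obtain i where i: "i < n" "x \<in> P i"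
      by blast
    then have "x \<notin> P j" if "j \<noteq> i" for j
      using disj that unfolding disjoint_family_on_def by blast
    then have "(\<Sum>j<n. l j * a j x) = (\<Sum>j<n. if j = i then f x else 0)"
      using i by (intro sum.cong) (auto simp: summand)
    then show ?thesis
      using i True by simp
  qed (simp add: summand)
  \<comment> \<open>By disjointness a partial sum is \<open>f\<close> restricted to the first
    \<open>n\<close> pieces. The remainder is therefore dominated by the modulus of \<open>f\<close>
    and is eventually 0 at almost every point.\<close>
  have "(\<lambda>n. \<integral>\<^sup>+x. ennreal (norm (f x - (\<Sum>j<n. l j * a j x))) \<partial>M) \<longlonglongrightarrow> (\<integral>\<^sup>+x. 0 \<partial>M)"
  proof (rule nn_integral_dominated_convergence)
    show "(\<lambda>x. ennreal (norm (f x - (\<Sum>j<n. l j * a j x)))) \<in> borel_measurable M" for n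
      unfolding partial by measurable
    show "AE x in M. ennreal (norm (f x - (\<Sum>j<n. l j * a j x))) \<le> ennreal (norm (f x))" for n
      unfolding partial by simp
    show "(\<integral>\<^sup>+x. ennreal (norm (f x)) \<partial>M) < \<infinity>"
      by (simp add: f_int)
    show "AE x in M. (\<lambda>n. ennreal (norm (f x - (\<Sum>j<n. l j * a j x)))) \<longlonglongrightarrow> 0"
      using cover
    proof eventually_elim
      case (elim x)
      obtain N where N: "f x \<noteq> 0 \<longrightarrow> x \<in> P N"
        using elim by blast
      have "eventually (\<lambda>n. ennreal (norm (f x - (\<Sum>j<n. l j * a j x))) = 0) sequentially"
        using eventually_gt_at_top[of N]
        by eventually_elim (use N in \<open>auto simp: partial\<close>)
      then show ?case
        by (rule tendsto_eventually)
    qed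
  qed measurable
  then have "block_decomposition M d q 0 f l a"
    using block c_summable c_nonneg by (simp add: block_decomposition_def Lq_norm_1 l_def)
  moreover have "(\<Sum>j. norm (l j)) \<le> 4 * D * L1_norm M f"
    using sums_le c_nonneg by (simp add: l_def)
  ultimately show ?thesis
    by (rule that)
qed

section \<open>Comparison of the block norm with the integral norm\<close>

lemma block_space_eq_L1:
  assumes q: "1 < q"
  shows "block_space M d q 0 = L1_space M"
  unfolding block_space_def L1_space_def using block_decomposition_exists[OF _ q] by blast

lemma block_norm_equivalent:
  assumes f: "f \<in> L1_space M" and q: "1 < q"
  shows "L1_norm M f \<le> block_norm M d q 0 f" "block_norm M d q 0 f \<le> 4 * D * L1_norm M f"
proof -
  have f: "integrable M f"
    using f by (simp add: L1_space_def)
  define K where "K = {(\<Sum>j. norm (l j)) | l. \<exists>a. block_decomposition M d q 0 f l a}"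
  have lower: "L1_norm M f \<le> t" if "t \<in> K" for t
    using that block_decomposition_L1_le[OF qball_sets _ q f] by (auto simp: K_def)
  obtain l a where la: "block_decomposition M d q 0 f l a" "(\<Sum>j. norm (l j)) \<le> 4 * D * L1_norm M f"
    using block_decomposition_exists[OF f q] by blast
  then have mem: "(\<Sum>j. norm (l j)) \<in> K"
    by (auto simp: K_def)
  then show "L1_norm M f \<le> block_norm M d q 0 f"
    unfolding block_norm_def K_def[symmetric] using lower by (intro cInf_greatest) auto
  have "Inf K \<le> (\<Sum>j. norm (l j))"
    using mem lower by (intro cInf_lower) (auto intro!: bdd_belowI)
  then show "block_norm M d q 0 f \<le> 4 * D * L1_norm M f"
    unfolding block_norm_def K_def[symmetric] using la by simp
qed

end

section \<open>From Ahlfors regularity to local doubling\<close>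

lemma ahlfors_regular_volume_bounds:
  assumes "ahlfors_regular_space M d s"
  obtains c C where "0 < c" "0 < C"
    "\<And>x r. x \<in> space M \<Longrightarrow> 0 < r \<Longrightarrow> ennreal r < qdiam (space M) d \<Longrightarrow>
      ennreal (c * r powr s) \<le> emeasure M (qball (space M) d x r)"
    "\<And>x r. x \<in> space M \<Longrightarrow> 0 < r \<Longrightarrow> ennreal r < qdiam (space M) d \<Longrightarrow>
      emeasure M (qball (space M) d x r) \<le> ennreal (C * r powr s)"
proof -
  have "\<exists>c>0. \<exists>C>0. \<forall>x\<in>space M. \<forall>r>0. ennreal r < qdiam (space M) d \<longrightarrow>
      ennreal (c * r powr s) \<le> emeasure M (qball (space M) d x r) \<and>
      emeasure M (qball (space M) d x r) \<le> ennreal (C * r powr s)"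
    using assms by (simp only: ahlfors_regular_space_def)
  then obtain c C where "0 < c" "0 < C" and
    bounds: "\<forall>x\<in>space M. \<forall>r>0. ennreal r < qdiam (space M) d \<longrightarrow>
      ennreal (c * r powr s) \<le> emeasure M (qball (space M) d x r) \<and>
      emeasure M (qball (space M) d x r) \<le> ennreal (C * r powr s)"
    by (elim exE conjE) (rule that)
  then show ?thesis
    using that by simp
qed

text \<open>If the diameter is infinite, the upper volume bound holds at all radii, so the balls of
  integer radius about one point exhaust the space by sets of finite measure.\<close>

lemma ahlfors_regular_space_sigma_finite:
  assumes reg: "ahlfors_regular_space M d s"
    and fin: "qdiam (space M) d < \<infinity> \<Longrightarrow> sigma_finite_measure M"
  shows "sigma_finite_measure M"
proof (cases "qdiam (space M) d < \<infinity>")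
  case False
  then have diam: "qdiam (space M) d = \<infinity>"
    by (metis infinity_ennreal_def top.not_eq_extremum)
  have balls: "\<And>x r. x \<in> space M \<Longrightarrow> qball (space M) d x r \<in> sets M"
    using reg by (simp add: ahlfors_regular_space_def)
  obtain C where C: "\<And>x r. x \<in> space M \<Longrightarrow> 0 < r \<Longrightarrow>
      emeasure M (qball (space M) d x r) \<le> ennreal (C * r powr s)"
    using ahlfors_regular_volume_bounds[OF reg] diam by (metis ennreal_less_top infinity_ennreal_def)
  have "space M \<noteq> {}"
    using reg by (auto simp: ahlfors_regular_space_def)
  then obtain x where x: "x \<in> space M"
    by blast
  have "y \<in> (\<Union>n. qball (space M) d x (Suc n))" if "y \<in> space M" for y
  proof -
    obtain n where "d x y < real n"
      using reals_Archimedean2 by blast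
    then show ?thesis
      using that by (auto simp: qball_def intro!: exI[of _ n])
  qed
  moreover have "emeasure M (qball (space M) d x (Suc n)) \<noteq> \<infinity>" for n
    using C[OF x, of "Suc n"] by (auto simp: top_unique)
  ultimately show ?thesis
    using balls[OF x]
    by (intro sigma_finite_measure.intro exI[of _ "range (\<lambda>n. qball (space M) d x (Suc n))"])
      (auto simp: qball_def)
qed (rule fin)

lemma ahlfors_regular_locally_doubling:
  assumes reg: "ahlfors_regular_space M d s"
    and sf: "sigma_finite_measure M"
  shows "\<exists>A r0 D. locally_doubling_space M d A r0 D"
proof -
  have qmo: "quasi_metric_on (space M) d"
    using reg by (simp add: ahlfors_regular_space_def)
  note metric = qmo[unfolded quasi_metric_on_def, THEN conjunct1]
  obtain A where "1 \<le> A"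
    and tri: "\<forall>x\<in>space M. \<forall>y\<in>space M. \<forall>z\<in>space M. d x y \<le> A * (d x z + d z y)"
    using qmo[unfolded quasi_metric_on_def, THEN conjunct2] by (elim exE conjE that)
  have qm: "quasi_metric_space (space M) d A"
  proof
    fix x y assume xy: "x \<in> space M" "y \<in> space M"
    note * = bspec[OF bspec[OF metric xy(1)] xy(2)]
    show "0 \<le> d x y" using * by (elim conjE)
    show "d x y = d y x" using * by (elim conjE)
    show "d x y = 0 \<longleftrightarrow> x = y" using * by (elim conjE)
    show "d x y \<le> A * (d x z + d z y)" if "z \<in> space M" for z
      using tri xy that by blast
  qed fact
  interpret quasi_metric_space "space M" d A by (rule qm)
  have balls: "\<And>x r. x \<in> space M \<Longrightarrow> qball (space M) d x r \<in> sets M"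
    and regular: "borel_regular M d" and nz: "emeasure M (space M) \<noteq> 0"
    using reg by (simp_all add: ahlfors_regular_space_def)
  have nonempty: "space M \<noteq> {}"
    using nz by auto
  have dist_le: "ennreal (d x y) \<le> qdiam (space M) d" if "x \<in> space M" "y \<in> space M" for x y
    unfolding qdiam_def using that by (meson SUP_upper2 order_refl)
  show ?thesis
  proof (cases "qdiam (space M) d = 0")
    \<comment> \<open>The space is a single point and no positive radius lies below the diameter, so
      the volume bounds say nothing. Sigma-finiteness makes the mass of the point finite, and every
      ball of positive radius is the whole space, so \<open>r0 = 1\<close> and \<open>D = 1\<close>
      work.\<close>
    case True
    then have single: "x = y" if "x \<in> space M" "y \<in> space M" for x y
      using dist_le[OF that] nonneg[OF that] zero_iff[OF that] by (simp add: ennreal_eq_0_iff)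
    have ball: "qball (space M) d x r = space M" if "x \<in> space M" "0 < r" for x r
      using centre_in_qball[OF that] single that by (auto simp: qball_def)
    obtain G :: "nat \<Rightarrow> 'a set" where G: "range G \<subseteq> sets M" "(\<Union>i. G i) = space M"
      "\<And>i. emeasure M (G i) \<noteq> \<infinity>"
      using sigma_finite_measure.sigma_finite[OF sf] by blast
    obtain x i where "x \<in> space M" "x \<in> G i"
      using nonempty G(2) by blast
    then have "G i = space M"
      using single G(2) by blast
    then have fin: "emeasure M (space M) < \<infinity>"
      using G(3)[of i] by (simp add: top.not_eq_extremum)
    have "locally_doubling_space M d A 1 1"
      using qm sf balls nonempty regular nz fin ball ge_1
      by (auto simp: locally_doubling_space_def locally_doubling_space_axioms_def zero_less_iff_neq_zero)
    then show ?thesis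
      by blast
  next
    case False
    then obtain e where e: "0 < e" "e < qdiam (space M) d"
      using dense[of 0 "qdiam (space M) d"] by (auto simp: zero_less_iff_neq_zero)
    then obtain r0 where r0: "0 < r0" "ennreal r0 < qdiam (space M) d"
      by (cases e) auto
    obtain c C where cC: "0 < c" "0 < C" and lower: "\<And>x r. x \<in> space M \<Longrightarrow> 0 < r \<Longrightarrow>
        ennreal r < qdiam (space M) d \<Longrightarrow> ennreal (c * r powr s) \<le> emeasure M (qball (space M) d x r)"
      and upper: "\<And>x r. x \<in> space M \<Longrightarrow> 0 < r \<Longrightarrow>
        ennreal r < qdiam (space M) d \<Longrightarrow> emeasure M (qball (space M) d x r) \<le> ennreal (C * r powr s)"
      using ahlfors_regular_volume_bounds[OF reg] by blast
    have small: "ennreal r < qdiam (space M) d" if "r \<le> r0" for r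
      using r0(2) by (rule order.strict_trans1[OF ennreal_leI[OF that]])
    \<comment> \<open>The ratio of the upper volume bound at radius \<open>2 * A * r\<close> to the
      lower one at radius \<open>r\<close>, in which \<open>r\<close> cancels.\<close>
    define D where "D = C * (2 * A) powr s / c"
    have "locally_doubling_space_axioms M d A r0 D"
    proof
      show "0 < D"
        using cC ge_1 by (simp add: D_def)
      fix x r assume x: "x \<in> space M" and r: "0 < (r::real)"
      show "0 < emeasure M (qball (space M) d x r)" if "r \<le> r0"
        using lower[OF x r small[OF that]] cC r
        by (metis ennreal_less_zero_iff mult_pos_pos order_less_le_trans powr_gt_zero less_numeral_extra(3))
      show "emeasure M (qball (space M) d x r) < \<infinity>" if "r \<le> r0"
        using upper[OF x r small[OF that]] by (auto simp: less_top intro: order.strict_trans1)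
      show "emeasure M (qball (space M) d x (2 * A * r)) \<le> ennreal D * emeasure M (qball (space M) d x r)"
        if le: "2 * A * r \<le> r0"
      proof -
        have "1 * r \<le> 2 * A * r"
          using ge_1 r by (intro mult_right_mono) auto
        then have r_le: "r \<le> r0"
          using le by simp
        have "emeasure M (qball (space M) d x (2 * A * r)) \<le> ennreal (C * (2 * A * r) powr s)"
          using ge_1 r by (intro upper x small le) auto
        also have "C * (2 * A * r) powr s = D * (c * r powr s)"
          using cC ge_1 r by (simp add: D_def powr_mult)
        also have "ennreal \<dots> = ennreal D * ennreal (c * r powr s)"
          using cC by (intro ennreal_mult) (auto simp: D_def)
        also have "\<dots> \<le> ennreal D * emeasure M (qball (space M) d x r)"
          by (intro mult_left_mono lower x r small r_le) auto
        finally show ?thesis .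
      qed
    qed (use balls nonempty regular r0 in auto)
    then have "locally_doubling_space M d A r0 D"
      using qm sf by (simp add: locally_doubling_space_def)
    then show ?thesis
      by blast
  qed
qed

theorem theorem1p13:
  fixes M :: "'a measure" and d :: "'a \<Rightarrow> 'a \<Rightarrow> real" and s :: real
  assumes "ahlfors_regular_space M d s"
    and "qdiam (space M) d < \<infinity> \<Longrightarrow> sigma_finite_measure M"
  shows "\<forall>q>1. block_space M d q 0 = L1_space M \<and>
           (\<exists>C1>0. \<exists>C2>0. \<forall>f\<in>L1_space M.
              C1 * L1_norm M f \<le> block_norm M d q 0 f \<and>
              block_norm M d q 0 f \<le> C2 * L1_norm M f)"
proof -
  obtain A r0 D where "locally_doubling_space M d A r0 D"
    using ahlfors_regular_locally_doubling[OF assms(1)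
        ahlfors_regular_space_sigma_finite[OF assms]] by blast
  then interpret locally_doubling_space M d A r0 D .
  show ?thesis
  proof (intro allI impI conjI)
    fix q :: ennreal assume q: "1 < q"
    show "block_space M d q 0 = L1_space M"
      using q by (rule block_space_eq_L1)
    show "\<exists>C1>0. \<exists>C2>0. \<forall>f\<in>L1_space M. C1 * L1_norm M f \<le> block_norm M d q 0 f \<and>
        block_norm M d q 0 f \<le> C2 * L1_norm M f"
      using block_norm_equivalent[OF _ q] D_pos
      by (intro exI[of _ 1] exI[of _ "4 * D"] conjI ballI) auto
  qed
qed

end
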